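(* Let $I\subset k[\mathbf{P}^N]$ be a homogeneous ideal defining a $0$-dimensional subscheme of $\mathbf{P}^N$ and let $c>\omega(I)/\gamma(I)$ be a real number. Then $I^{(m)}\subseteq I^r$ for all but finitely many pairs $(m,r)$ of positive integers with $m/r\ge c$. In particular, if $m,r$ are positive integers with $m/r>\omega(I)/\gamma(I)$, then $I^{(mt)}\subseteq I^{rt}$ for all integers $t\gg 0$.
   Context: $k$ is an arbitrary algebraically closed field, $N\ge 1$, and $k[\mathbf{P}^N]=k[x_0,\dots,x_N]$ is the polynomial ring with its standard grading. Symbolic powers: for a homogeneous ideal $0\ne I\subsetneq R=k[\mathbf{P}^N]$ and $m\ge 1$, $I^{(m)}$ is the contraction to $R$ of $I^mR_A$, where $R_A$ is the localization of $R$ at the multiplicative system $A$ equal to the complement of the union of the associated primes of $I$. $\alpha(J)$, for a nonzero homogeneous ideal $J$, is the least degree $t$ with $J_t\ne 0$. $\gamma(I)=\lim_{m\to\infty}\alpha(I^{(m)})/m$; this limit exists by subadditivity of $m\mapsto\alpha(I^{(m)})$, and is positive. $\omega(I)$ is the maximum degree of a generator in any minimal set of homogeneous generators of $I$ (equivalently, the least $t$ such that $I$ is generated by forms of degree at most $t$). "Defines a $0$-dimensional subscheme" means the closed subscheme of $\mathbf{P}^N$ determined by $I$ is nonempty of dimension $0$. *)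

theory Defs
  imports
    "HOL-Analysis.Analysis"
    "HOL-Algebra.Algebraic_Closure_Type"
    "HOL-Algebra.Ideal_Product"
    "HOL-Computational_Algebra.Fraction_Field"
    "HOL-Library.Poly_Mapping"
begin

section \<open>The homogeneous coordinate ring\<close>

text \<open>
  Polynomials over \<open>'k\<close> in variables indexed by the finite type \<open>'n\<close>; a projective space of
  dimension \<open>N\<close> corresponds to \<open>CARD('n) = N + 1\<close>. The order on \<open>'n\<close> carries no
  content: it is what the library needs to know that this ring is an integral domain.
\<close>

type_synonym ('n, 'k) mpoly = "('n \<Rightarrow>\<^sub>0 nat) \<Rightarrow>\<^sub>0 'k"

abbreviation poly_ring :: "('n::finite, 'k::field) mpoly ring" where
  "poly_ring \<equiv> ring_of_type_algebra"

definition mon_degree :: "('n::finite \<Rightarrow>\<^sub>0 nat) \<Rightarrow> nat" where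
  "mon_degree a = (\<Sum>i\<in>UNIV. Poly_Mapping.lookup a i)"

definition form :: "nat \<Rightarrow> ('n::finite, 'k::field) mpoly \<Rightarrow> bool" where
  "form t f \<longleftrightarrow> (\<forall>a\<in>Poly_Mapping.keys f. mon_degree a = t)"

definition homogeneous_ideal :: "('n::finite, 'k::field) mpoly set \<Rightarrow> bool" where
  "homogeneous_ideal I \<longleftrightarrow>
     ideal I poly_ring \<and> I = Idl\<^bsub>poly_ring\<^esub> {f \<in> I. \<exists>t. form t f}"

definition ideal_power :: "('n::finite, 'k::field) mpoly set \<Rightarrow> nat \<Rightarrow> ('n, 'k) mpoly set" where
  "ideal_power I m = I [^]\<^bsub>ideals_set poly_ring\<^esub> m"


section \<open>Symbolic powers\<close>

text \<open>Primes that are annihilators of elements of the quotient module by \<open>I\<close>.\<close>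

definition associated_primes ::
    "('n::finite, 'k::field) mpoly set \<Rightarrow> ('n, 'k) mpoly set set" where
  "associated_primes I = {P. primeideal P poly_ring \<and> (\<exists>f. P = {g. g * f \<in> I})}"

text \<open>
  Localization of an integral domain at a multiplicative system \<open>A\<close> not containing \<open>0\<close>,
  realized inside the fraction field.
\<close>

definition localization :: "'a::idom set \<Rightarrow> 'a fract ring" where
  "localization A =
     ring_of_type_algebra\<lparr>carrier := {Fraction_Field.Fract a s | a s. s \<in> A}\<rparr>"

definition symbolic_power ::
    "('n::{finite,linorder}, 'k::field) mpoly set \<Rightarrow> nat \<Rightarrow> ('n, 'k) mpoly set" where
  "symbolic_power I m =
     (let A = - \<Union>(associated_primes I);
          \<iota> = (\<lambda>f. Fraction_Field.Fract f 1)
      in \<iota> -` (Idl\<^bsub>localization A\<^esub> (\<iota> ` ideal_power I m)))"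


section \<open>Numerical invariants\<close>

definition alpha :: "('n::finite, 'k::field) mpoly set \<Rightarrow> nat" where
  "alpha J = (LEAST t. \<exists>f\<in>J. f \<noteq> 0 \<and> form t f)"

definition gamma :: "('n::{finite,linorder}, 'k::field) mpoly set \<Rightarrow> real" where
  "gamma I = lim (\<lambda>m. real (alpha (symbolic_power I m)) / real m)"

definition omega :: "('n::finite, 'k::field) mpoly set \<Rightarrow> nat" where
  "omega I = (LEAST t. I = Idl\<^bsub>poly_ring\<^esub> {f \<in> I. \<exists>d\<le>t. form d f})"


section \<open>Dimension of the closed subscheme defined by an ideal\<close>

definition irreducible_closedin :: "'a topology \<Rightarrow> 'a set \<Rightarrow> bool" where
  "irreducible_closedin T Z \<longleftrightarrow>
     closedin T Z \<and> Z \<noteq> {} \<and>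
     (\<forall>U V. closedin T U \<longrightarrow> closedin T V \<longrightarrow> Z = U \<union> V \<longrightarrow> Z = U \<or> Z = V)"

text \<open>The dimension of the empty space is \<open>-\<infinity>\<close>.\<close>

definition krull_dim :: "'a topology \<Rightarrow> ereal" where
  "krull_dim T = Sup {ereal (real n) | n.
     \<exists>Z. (\<forall>i\<le>n. irreducible_closedin T (Z i)) \<and> (\<forall>i<n. Z i \<subset> Z (Suc i))}"

definition irrelevant_ideal :: "('n::finite, 'k::field) mpoly set" where
  "irrelevant_ideal = {f. Poly_Mapping.lookup f 0 = 0}"

definition proj_points :: "('n::finite, 'k::field) mpoly set set" where
  "proj_points =
     {P. primeideal P poly_ring \<and> homogeneous_ideal P \<and> \<not> irrelevant_ideal \<subseteq> P}"

definition zariski_topology :: "('n::finite, 'k::field) mpoly set topology" where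
  "zariski_topology = topology_generated_by
     {{P \<in> proj_points. f \<notin> P} | f. \<exists>t. form t f}"

text \<open>The underlying space of the closed subscheme defined by \<open>I\<close>.\<close>

definition subscheme_space ::
    "('n::finite, 'k::field) mpoly set \<Rightarrow> ('n, 'k) mpoly set topology" where
  "subscheme_space I = subtopology zariski_topology {P \<in> proj_points. I \<subseteq> P}"

definition defines_zero_dim_subscheme :: "('n::finite, 'k::field) mpoly set \<Rightarrow> bool" where
  "defines_zero_dim_subscheme I \<longleftrightarrow>
     topspace (subscheme_space I) \<noteq> {} \<and> krull_dim (subscheme_space I) = 0"

end

theory Submission
  imports Defs "HOL-Computational_Algebra.Polynomial"
begin

text \<open>
  In the Noetherian Rees algebra of \<open>I\<close>, the elements \<open>g z\<^sup>r\<close> with \<open>g \<in> I\<^sup>r\<close> that some power of the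
  irrelevant ideal multiplies into \<open>I\<^sup>r\<^sup>+\<^sup>1\<close> span a finitely generated ideal. Comparing degrees with its
  generators gives a constant \<open>e\<close> such that a form of degree at least \<open>\<omega>(I) r + e\<close> in the
  saturation of \<open>I\<^sup>r\<close> lies in \<open>I\<^sup>r\<close>. For a zero-dimensional subscheme the symbolic power \<open>I\<^sup>(\<^sup>m\<^sup>)\<close> is
  homogeneous and contained in the saturation of \<open>I\<^sup>m\<close>, because every homogeneous prime over \<open>I\<close>
  other than the irrelevant one is associated to \<open>I\<close>. As the forms in \<open>I\<^sup>(\<^sup>m\<^sup>)\<close> have degree at least
  \<open>m \<gamma>(I)\<close>, it follows that \<open>I\<^sup>(\<^sup>m\<^sup>) \<subseteq> I\<^sup>r\<close> as soon as \<open>m \<ge> r\<close> and \<open>m \<gamma>(I) \<ge> \<omega>(I) r + e\<close>, which fails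
  for only finitely many pairs with \<open>m \<ge> c r\<close>. That \<open>\<gamma>(I)\<close> is at least \<open>1\<close> is seen by Taylor expansion
  at the generic point of an associated prime.
\<close>


section \<open>Noetherian subrings\<close>

hide_const (open) up_ring.coeff up_ring.monom Polynomials.degree Polynomials.lead_coeff module.smult

text \<open>The obstacle is uniformity in \<open>r\<close>: each \<open>I^r\<close> agrees with its
  saturation in large degrees, but the bound must be linear in \<open>r\<close> with slope exactly
  \<open>omega I\<close> and a constant free of \<open>r\<close>. Both come from one factorization:
  \<open>I^k\<close> is generated in degrees at most \<open>omega I * k\<close>, so a form in
  \<open>I^k\<close> of degree at least \<open>omega I * k + q\<close> is a combination of such
  generators with coefficients of degree at least \<open>q\<close>, enough to use up a saturation
  exponent \<open>q\<close>. The passage is only from \<open>I^r\<close> to \<open>I^(r+1)\<close>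
  because \<open>g z^r\<close> must lie in the Rees algebra; longer passages are chains of such
  steps. The inequality \<open>gamma I \<ge> 1\<close> makes the quotient
  \<open>omega I / gamma I\<close> meaningful, and \<open>gamma I \<le> omega I\<close> forces
  \<open>c > 1\<close>, hence \<open>r \<le> m\<close>, so that the saturation of \<open>I^m\<close>
  lies in that of \<open>I^r\<close>. Homogeneity of \<open>I^(m)\<close> is not automatic, since
  the denominators of the localization need not be forms; it is required because all degree
  estimates are made on components.\<close>

definition is_ideal :: "'a::comm_ring_1 set \<Rightarrow> bool" where
  "is_ideal J \<longleftrightarrow> 0 \<in> J \<and> (\<forall>x\<in>J. \<forall>y\<in>J. x + y \<in> J) \<and> (\<forall>r. \<forall>x\<in>J. r * x \<in> J)"

definition is_prime :: "'a::comm_ring_1 set \<Rightarrow> bool" where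
  "is_prime P \<longleftrightarrow> is_ideal P \<and> 1 \<notin> P \<and> (\<forall>a b. a * b \<in> P \<longrightarrow> a \<in> P \<or> b \<in> P)"

text \<open>Subrings are plain sets inside an ambient ring type, so that the Rees algebra can live
  inside the polynomials in one more variable.\<close>

definition ring_closed :: "'a::comm_ring_1 set \<Rightarrow> bool" where
  "ring_closed A \<longleftrightarrow> 0 \<in> A \<and> 1 \<in> A \<and> (\<forall>x\<in>A. \<forall>y\<in>A. x + y \<in> A \<and> x - y \<in> A \<and> x * y \<in> A)"

text \<open>For \<open>A = UNIV\<close> this is the ideal generated by \<open>Z\<close>; for a
  subring \<open>A\<close> it is an \<open>A\<close>-submodule of the ambient ring. Adding one
  multiple at a time spares indexed sums; \<open>lspan_sum\<close> recovers them when they are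
  wanted.\<close>

inductive_set lspan :: "'a::comm_ring_1 set \<Rightarrow> 'a set \<Rightarrow> 'a set" for A Z where
  zero: "0 \<in> lspan A Z"
| step: "a \<in> A \<Longrightarrow> x \<in> Z \<Longrightarrow> y \<in> lspan A Z \<Longrightarrow> a * x + y \<in> lspan A Z"

text \<open>The generators are chosen from \<open>Z\<close> itself, and \<open>Z\<close> is any
  subset. Hence a set of forms has finitely many forms among its elements that generate the same
  ideal.\<close>

definition noetherian :: "'a::comm_ring_1 set \<Rightarrow> bool" where
  "noetherian A \<longleftrightarrow> (\<forall>Z\<subseteq>A. \<exists>F\<subseteq>Z. finite F \<and> Z \<subseteq> lspan A F)"

lemma is_ideal_zero: "is_ideal J \<Longrightarrow> 0 \<in> J"
  and is_ideal_add: "is_ideal J \<Longrightarrow> x \<in> J \<Longrightarrow> y \<in> J \<Longrightarrow> x + y \<in> J"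
  and is_ideal_mult: "is_ideal J \<Longrightarrow> x \<in> J \<Longrightarrow> r * x \<in> J"
  by (auto simp: is_ideal_def)

lemma is_ideal_mult_right: "is_ideal J \<Longrightarrow> x \<in> J \<Longrightarrow> x * r \<in> J"
  using is_ideal_mult[of J x r] by (simp add: mult.commute)

lemma is_ideal_uminus: "is_ideal J \<Longrightarrow> x \<in> J \<Longrightarrow> - x \<in> J"
  using is_ideal_mult[of J x "-1"] by simp

lemma is_ideal_diff: "is_ideal J \<Longrightarrow> x \<in> J \<Longrightarrow> y \<in> J \<Longrightarrow> x - y \<in> J"
  using is_ideal_add[of J x "-y"] is_ideal_uminus[of J y] by simp

lemma is_ideal_sum: "is_ideal J \<Longrightarrow> (\<And>i. i \<in> S \<Longrightarrow> f i \<in> J) \<Longrightarrow> sum f S \<in> J"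
  by (induction S rule: infinite_finite_induct) (auto simp: is_ideal_zero is_ideal_add)

lemma is_ideal_one: "is_ideal J \<Longrightarrow> 1 \<in> J \<Longrightarrow> J = UNIV"
  using is_ideal_mult[of J 1] by auto

lemma is_prime_ideal: "is_prime P \<Longrightarrow> is_ideal P"
  and is_prime_one: "is_prime P \<Longrightarrow> 1 \<notin> P"
  and is_prime_mult: "is_prime P \<Longrightarrow> a * b \<in> P \<Longrightarrow> a \<in> P \<or> b \<in> P"
  by (auto simp: is_prime_def)

lemma is_prime_power: "is_prime P \<Longrightarrow> a ^ n \<in> P \<Longrightarrow> a \<in> P"
  by (induction n) (auto simp: is_prime_one dest: is_prime_mult)

lemma ring_closed_UNIV: "ring_closed UNIV"
  by (simp add: ring_closed_def)

lemma is_ideal_colon: "is_ideal I \<Longrightarrow> is_ideal {g. g * f \<in> I}"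
  by (auto simp: is_ideal_def distrib_right mult.assoc)

lemma lspan_add: "x \<in> lspan A Z \<Longrightarrow> y \<in> lspan A Z \<Longrightarrow> x + y \<in> lspan A Z"
  by (induction rule: lspan.induct) (auto simp: add.assoc intro: lspan.step)

lemma lspan_mult:
  assumes "ring_closed A" "y \<in> lspan A Z" "a \<in> A"
  shows "a * y \<in> lspan A Z"
  using assms(2)
proof induction
  case (step b x y)
  have "(a * b) * x + a * y \<in> lspan A Z"
    using step assms by (intro lspan.step) (auto simp: ring_closed_def)
  then show ?case by (simp add: algebra_simps)
qed (simp add: lspan.zero)

lemma lspan_base: "ring_closed A \<Longrightarrow> x \<in> Z \<Longrightarrow> x \<in> lspan A Z"
  using lspan.step[OF _ _ lspan.zero, of 1 A x Z] by (auto simp: ring_closed_def)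

lemma lspan_closed:
  assumes "y \<in> lspan A Z" "0 \<in> J" "\<And>x y. x \<in> J \<Longrightarrow> y \<in> J \<Longrightarrow> x + y \<in> J"
    "\<And>a x. a \<in> A \<Longrightarrow> x \<in> Z \<Longrightarrow> a * x \<in> J"
  shows "y \<in> J"
  using assms(1) by induction (auto simp: assms)

lemma lspan_trans:
  assumes "ring_closed A" "Z \<subseteq> lspan A Y"
  shows "lspan A Z \<subseteq> lspan A Y"
proof
  fix y assume "y \<in> lspan A Z"
  then show "y \<in> lspan A Y"
    by (rule lspan_closed) (use assms in \<open>auto simp: lspan.zero intro: lspan_add lspan_mult\<close>)
qed

lemma lspan_mono: "Z \<subseteq> Y \<Longrightarrow> lspan A Z \<subseteq> lspan A Y"
proof
  fix y assume "Z \<subseteq> Y" and "y \<in> lspan A Z"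
  from this(2,1) show "y \<in> lspan A Y"
    by (induction rule: lspan.induct) (auto intro: lspan.intros)
qed

lemma lspan_finite:
  assumes "y \<in> lspan A Z"
  shows "\<exists>F\<subseteq>Z. finite F \<and> y \<in> lspan A F"
  using assms
proof induction
  case (step a x y)
  then obtain F where F: "F \<subseteq> Z" "finite F" "y \<in> lspan A F" by auto
  have "a * x + y \<in> lspan A (insert x F)"
    using step F lspan_mono[of F "insert x F" A] by (intro lspan.step) auto
  then show ?case using F step by (intro exI[of _ "insert x F"]) auto
qed (auto intro: lspan.zero)

lemma lspan_subset: "ring_closed A \<Longrightarrow> Z \<subseteq> A \<Longrightarrow> lspan A Z \<subseteq> A"
  by (auto elim!: lspan_closed simp: ring_closed_def)

lemma lspan_ideal: "is_ideal J \<Longrightarrow> Z \<subseteq> J \<Longrightarrow> lspan A Z \<subseteq> J"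
  by (auto elim!: lspan_closed simp: is_ideal_def subset_iff)

lemma is_ideal_lspan: "is_ideal (lspan UNIV Z)"
  by (auto simp: is_ideal_def lspan.zero lspan_add lspan_mult ring_closed_UNIV)

lemma lspan_sum:
  assumes "finite F" "y \<in> lspan A F" "ring_closed A"
  shows "\<exists>c. (\<forall>x\<in>F. c x \<in> A) \<and> y = (\<Sum>x\<in>F. c x * x)"
  using assms(2)
proof induction
  case zero
  show ?case using assms by (intro exI[of _ "\<lambda>_. 0"]) (auto simp: ring_closed_def)
next
  case (step a x y)
  then obtain c where c: "\<forall>x\<in>F. c x \<in> A" "y = (\<Sum>x\<in>F. c x * x)" by auto
  have "(\<Sum>z\<in>F. (c z + (if z = x then a else 0)) * z) = y + (\<Sum>z\<in>F. if z = x then a * x else 0)"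
    unfolding c(2) sum.distrib[symmetric] by (intro sum.cong) (auto simp: algebra_simps)
  also have "\<dots> = a * x + y" using step assms by simp
  finally show ?case using c step assms
    by (intro exI[of _ "\<lambda>z. c z + (if z = x then a else 0)"]) (auto simp: ring_closed_def)
qed

section \<open>Hilbert's basis theorem and finitely generated extensions\<close>

definition coeffs_in :: "'a::comm_ring_1 set \<Rightarrow> 'a poly set" where
  "coeffs_in A = {p. \<forall>i. coeff p i \<in> A}"

lemma sum_closed: "ring_closed A \<Longrightarrow> (\<And>i. i \<in> S \<Longrightarrow> f i \<in> A) \<Longrightarrow> sum f S \<in> A"
  by (induction S rule: infinite_finite_induct) (auto simp: ring_closed_def)

lemma ring_closed_coeffs_in: "ring_closed A \<Longrightarrow> ring_closed (coeffs_in A)"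
  apply (subst ring_closed_def)
  apply (auto simp: coeffs_in_def coeff_mult intro!: sum_closed)
      apply (auto simp: ring_closed_def)
  done

text \<open>A relation between leading coefficients lifts to polynomials once each
  \<open>p i\<close> is shifted by a monomial to the common degree \<open>d\<close>. Terms may
  cancel, so the coefficient at \<open>d\<close> is prescribed rather than the leading
  coefficient.\<close>

lemma lspan_lead_coeffs:
  assumes A: "ring_closed A" and c: "c \<in> lspan A ((\<lambda>i. lead_coeff (p i)) ` S)"
    and d: "\<And>i. i \<in> S \<Longrightarrow> degree (p i) \<le> d"
  shows "\<exists>q\<in>lspan (coeffs_in A) (p ` S). degree q \<le> d \<and> coeff q d = c"
  using c
proof induction
  case zero
  show ?case by (intro bexI[of _ 0]) (auto simp: lspan.zero)
next
  case (step a x y)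
  then obtain q i where q: "q \<in> lspan (coeffs_in A) (p ` S)" "degree q \<le> d" "coeff q d = y"
    and i: "i \<in> S" "x = lead_coeff (p i)" by auto
  let ?q = "monom a (d - degree (p i)) * p i + q"
  have "?q \<in> lspan (coeffs_in A) (p ` S)"
    using step q i A by (intro lspan.step) (auto simp: coeffs_in_def ring_closed_def)
  moreover have "degree (monom a (d - degree (p i)) * p i) \<le> d"
    using degree_mult_le[of "monom a (d - degree (p i))" "p i"] d[OF i(1)]
      degree_monom_le[of a "d - degree (p i)"] by linarith
  moreover have "coeff ?q d = a * x + y"
    using i d[OF i(1)] q by (simp add: coeff_monom_mult)
  ultimately show ?case using q by (intro bexI[of _ ?q]) (auto intro: degree_add_le)
qed

text \<open>Hilbert's basis theorem: if each \<open>p n\<close> has minimal degree outside the span of its predecessors,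
  a relation between the leading coefficients produces an element of smaller degree.\<close>

lemma noetherian_coeffs_in:
  fixes A :: "'a::comm_ring_1 set"
  assumes A: "ring_closed A" and nA: "noetherian A"
  shows "noetherian (coeffs_in A)"
  unfolding noetherian_def
proof (intro allI impI, rule ccontr)
  fix Z :: "'a poly set"
  assume Z: "Z \<subseteq> coeffs_in A" and no: "\<not> (\<exists>F\<subseteq>Z. finite F \<and> Z \<subseteq> lspan (coeffs_in A) F)"
  note B = ring_closed_coeffs_in[OF A]
  define J where "J = lspan (coeffs_in A) Z"
  have JA: "J \<subseteq> coeffs_in A" unfolding J_def by (rule lspan_subset[OF B Z])
  \<comment> \<open>Each element of \<open>G\<close> involves only finitely many elements of
    \<open>Z\<close>, so a finite \<open>G\<close> generating \<open>J\<close> would yield a finite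
    generating subset of \<open>Z\<close>.\<close>
  have noJ: "\<exists>q. q \<in> J \<and> q \<notin> lspan (coeffs_in A) G" if G: "finite G" "G \<subseteq> J" for G
  proof (rule ccontr)
    assume "\<not> ?thesis"
    then have JG: "J \<subseteq> lspan (coeffs_in A) G" by auto
    have "\<forall>g\<in>G. \<exists>F\<subseteq>Z. finite F \<and> g \<in> lspan (coeffs_in A) F"
      using G lspan_finite unfolding J_def by blast
    then obtain F where F: "\<And>g. g \<in> G \<Longrightarrow> F g \<subseteq> Z \<and> finite (F g) \<and> g \<in> lspan (coeffs_in A) (F g)"
      by metis
    have "G \<subseteq> lspan (coeffs_in A) (\<Union>(F ` G))"
      using F lspan_mono[of _ "\<Union>(F ` G)"] by blast
    then have "Z \<subseteq> lspan (coeffs_in A) (\<Union>(F ` G))"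
      using lspan_trans[OF B] JG lspan_base[OF B, of _ Z] unfolding J_def by blast
    moreover have "finite (\<Union>(F ` G))" "\<Union>(F ` G) \<subseteq> Z" using F G by auto
    ultimately show False using no by blast
  qed
  \<comment> \<open>The premise that the earlier values lie in \<open>J\<close> makes a suitable
    \<open>r\<close> exist for every \<open>f\<close>; for the sequence obtained, it is discharged
    by strong induction.\<close>
  define P where "P = (\<lambda>(f :: nat \<Rightarrow> 'a poly) n r. f ` {..<n} \<subseteq> J \<longrightarrow> r \<in> J \<and> r \<notin> lspan (coeffs_in A) (f ` {..<n}) \<and>
     (\<forall>q. q \<in> J \<and> q \<notin> lspan (coeffs_in A) (f ` {..<n}) \<longrightarrow> degree r \<le> degree q))"
  have "\<exists>p. \<forall>n. P p n (p n)"
  proof (rule dependent_wf_choice[OF wf_less_than])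
    fix n and f :: "nat \<Rightarrow> 'a poly"
    let ?Q = "\<lambda>q. q \<in> J \<and> q \<notin> lspan (coeffs_in A) (f ` {..<n})"
    show "\<exists>r. P f n r"
    proof (cases "f ` {..<n} \<subseteq> J")
      case True
      then obtain q where "?Q q" using noJ[of "f ` {..<n}"] by auto
      then have "?Q (arg_min degree ?Q) \<and> (\<forall>q. ?Q q \<longrightarrow> degree (arg_min degree ?Q) \<le> degree q)"
        by (rule arg_min_nat_lemma)
      then show ?thesis unfolding P_def by blast
    qed (auto simp: P_def)
  next
    fix f g :: "nat \<Rightarrow> 'a poly" and n r
    assume "\<And>z. (z, n) \<in> less_than \<Longrightarrow> f z = g z"
    then have "f ` {..<n} = g ` {..<n}" by (auto intro!: image_cong)
    then show "P f n r = P g n r" by (simp add: P_def)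
  qed
  then obtain p where "\<And>n. P p n (p n)" by auto
  note p = this[unfolded P_def]
  have pJ: "p n \<in> J" for n
    by (induction n rule: less_induct) (use p in blast)
  have pn: "p n \<notin> lspan (coeffs_in A) (p ` {..<n})" for n using p[of n] pJ by auto
  have pmin: "degree (p n) \<le> degree q" if "q \<in> J" "q \<notin> lspan (coeffs_in A) (p ` {..<n})" for n q
    using p[of n] pJ that by auto
  let ?l = "\<lambda>n. lead_coeff (p n)"
  have "range ?l \<subseteq> A" using pJ JA by (auto simp: coeffs_in_def)
  then obtain F where F: "F \<subseteq> range ?l" "finite F" "range ?l \<subseteq> lspan A F"
    using nA unfolding noetherian_def by meson
  obtain T where T: "finite T" "F = ?l ` T" using F(1,2) by (meson finite_subset_image)
  \<comment> \<open>Inserting \<open>0\<close> keeps \<open>Max\<close> defined when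
    \<open>T\<close> is empty. Since \<open>m\<close> exceeds every index in \<open>T\<close>, the
    leading coefficient of \<open>p m\<close> is a combination of earlier ones.\<close>
  define m where "m = Suc (Max (insert 0 T))"
  have Tm: "T \<subseteq> {..<m}"
  proof
    fix i assume "i \<in> T"
    then have "i \<le> Max (insert 0 T)" using T by (intro Max_ge) auto
    then show "i \<in> {..<m}" by (simp add: m_def)
  qed
  have lm: "?l m \<in> lspan A (?l ` {..<m})"
    using F(3) lspan_mono[of F "?l ` {..<m}" A] T Tm by blast
  have deg: "degree (p i) \<le> degree (p m)" if "i \<in> {..<m}" for i
  proof (rule pmin[OF pJ])
    show "p m \<notin> lspan (coeffs_in A) (p ` {..<i})"
      using pn[of m] lspan_mono[of "p ` {..<i}" "p ` {..<m}"] that by fastforce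
  qed
  obtain q where q: "q \<in> lspan (coeffs_in A) (p ` {..<m})" "degree q \<le> degree (p m)"
    "coeff q (degree (p m)) = ?l m"
    using lspan_lead_coeffs[OF A lm deg] by auto
  define r where "r = p m - q"
  have q0: "-1 * q \<in> lspan (coeffs_in A) (p ` {..<m})"
    by (rule lspan_mult[OF B q(1)]) (use B in \<open>auto simp: ring_closed_def
        dest: bspec[of _ _ 0]\<close>)
  have rn: "r \<notin> lspan (coeffs_in A) (p ` {..<m})"
    using pn[of m] lspan_add[OF _ q(1), of r] by (auto simp: r_def)
  have "lspan (coeffs_in A) (p ` {..<m}) \<subseteq> J"
    unfolding J_def by (rule lspan_trans[OF B]) (use pJ in \<open>auto simp: J_def\<close>)
  then have "r \<in> J"
    using lspan_add[of "p m" "coeffs_in A" Z "-1 * q"] pJ[of m] q0 by (auto simp: r_def J_def)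
  then have "degree (p m) \<le> degree r" using rn by (rule pmin)
  moreover have "degree r \<le> degree (p m)" "coeff r (degree (p m)) = 0"
    using q by (auto simp: r_def intro: degree_diff_le)
  ultimately have "lead_coeff r = 0" by simp
  then have "r = 0" by simp
  with rn show False by (simp add: lspan.zero)
qed

lemma noetherian_image:
  assumes A: "ring_closed A" and n: "noetherian A"
    and 0: "\<phi> 0 = 0" and add: "\<And>x y. \<phi> (x + y) = \<phi> x + \<phi> y" and mult: "\<And>x y. \<phi> (x * y) = \<phi> x * \<phi> y"
  shows "noetherian (\<phi> ` A)"
  unfolding noetherian_def
proof (intro allI impI)
  fix Z assume Z: "Z \<subseteq> \<phi> ` A"
  define Y where "Y = {y \<in> A. \<phi> y \<in> Z}"
  obtain F where F: "F \<subseteq> Y" "finite F" "Y \<subseteq> lspan A F"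
    using n unfolding noetherian_def Y_def by (metis (no_types, lifting) mem_Collect_eq subsetI)
  have "\<phi> y \<in> lspan (\<phi> ` A) (\<phi> ` F)" if "y \<in> lspan A F" for y
    using that by induction (auto simp: 0 add mult intro!: lspan.intros)
  then have "Z \<subseteq> lspan (\<phi> ` A) (\<phi> ` F)" using Z F(3) unfolding Y_def by blast
  then show "\<exists>F\<subseteq>Z. finite F \<and> Z \<subseteq> lspan (\<phi> ` A) F"
    using F by (intro exI[of _ "\<phi> ` F"]) (auto simp: Y_def)
qed

lemma ring_closed_power: "ring_closed A \<Longrightarrow> x \<in> A \<Longrightarrow> x ^ n \<in> A"
  by (induction n) (auto simp: ring_closed_def)

text \<open>Evaluation at \<open>b\<close> maps \<open>C[z]\<close> onto \<open>C[b]\<close>, so the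
  basis theorem applies to one new element at a time. The minimality clause bounds the extension
  from above without a description of its elements.\<close>

lemma noetherian_adjoin:
  fixes A :: "'a::comm_ring_1 set"
  assumes A: "ring_closed A" "noetherian A" and Z: "finite Z"
  shows "\<exists>C. ring_closed C \<and> noetherian C \<and> A \<union> Z \<subseteq> C \<and> (\<forall>D. ring_closed D \<longrightarrow> A \<union> Z \<subseteq> D \<longrightarrow> C \<subseteq> D)"
  using Z
proof induction
  case empty
  show ?case using A by (intro exI[of _ A]) auto
next
  case (insert b Z)
  then obtain C where C: "ring_closed C" "noetherian C" "A \<union> Z \<subseteq> C"
    "\<And>D. ring_closed D \<Longrightarrow> A \<union> Z \<subseteq> D \<Longrightarrow> C \<subseteq> D" by auto
  let ?E = "(\<lambda>p. poly p b) ` coeffs_in C"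
  note B = ring_closed_coeffs_in[OF C(1)]
  have "ring_closed ?E" unfolding ring_closed_def
  proof (intro conjI ballI)
    show "0 \<in> ?E" "1 \<in> ?E"
      using B image_eqI[of 0 "\<lambda>p. poly p b" 0 "coeffs_in C"] image_eqI[of 1 "\<lambda>p. poly p b" 1 "coeffs_in C"]
      by (auto simp: ring_closed_def)
    fix x y assume "x \<in> ?E" "y \<in> ?E"
    then obtain p q where "p \<in> coeffs_in C" "x = poly p b" "q \<in> coeffs_in C" "y = poly q b" by auto
    then show "x + y \<in> ?E" "x - y \<in> ?E" "x * y \<in> ?E"
      using B image_eqI[of "x + y" "\<lambda>p. poly p b" "p + q" "coeffs_in C"]
        image_eqI[of "x - y" "\<lambda>p. poly p b" "p - q" "coeffs_in C"]
        image_eqI[of "x * y" "\<lambda>p. poly p b" "p * q" "coeffs_in C"]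
      by (auto simp: ring_closed_def)
  qed
  moreover have "noetherian ?E"
    by (rule noetherian_image[OF B noetherian_coeffs_in[OF C(1,2)]]) auto
  moreover have "C \<subseteq> ?E"
    using C(1) by (auto simp: coeffs_in_def ring_closed_def coeff_pCons split: nat.split
        intro!: image_eqI[of _ _ "[:c:]" for c])
  moreover have "b \<in> ?E"
    using C(1) by (auto simp: coeffs_in_def ring_closed_def coeff_pCons split: nat.split
        intro!: image_eqI[of _ _ "[:0, 1:]"])
  moreover have "?E \<subseteq> D" if D: "ring_closed D" "A \<union> insert b Z \<subseteq> D" for D
  proof
    fix x assume "x \<in> ?E"
    then obtain p where p: "x = (\<Sum>i\<le>degree p. coeff p i * b ^ i)" "p \<in> coeffs_in C"
      by (auto simp: poly_altdef)
    have "coeff p i * b ^ i \<in> D" for i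
      using p(2) C(4)[OF D(1)] D ring_closed_power[OF D(1), of b i]
      by (auto simp: coeffs_in_def ring_closed_def)
    then show "x \<in> D" unfolding p(1) by (intro sum_closed[OF D(1)])
  qed
  ultimately show ?case using C(3) by (intro exI[of _ ?E]) auto
qed

section \<open>Associated and minimal primes\<close>

text \<open>Otherwise there is a strictly increasing chain; finitely many elements generate its
  union and all occur at one stage, where the chain has to stop.\<close>

lemma noetherian_maximal:
  fixes \<F> :: "'a::comm_ring_1 set set"
  assumes n: "noetherian (UNIV :: 'a set)" and ne: "\<F> \<noteq> {}" and id: "\<And>J. J \<in> \<F> \<Longrightarrow> is_ideal J"
  shows "\<exists>J\<in>\<F>. \<forall>K\<in>\<F>. J \<subseteq> K \<longrightarrow> K = J"
proof (rule ccontr)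
  assume c: "\<not> ?thesis"
  then have up: "\<exists>K. K \<in> \<F> \<and> J \<subset> K" if "J \<in> \<F>" for J
    using that by (auto simp: psubset_eq)
  have "\<exists>f. \<forall>n. f n \<in> \<F> \<and> f n \<subset> f (Suc n)"
    by (rule dependent_nat_choice) (use ne up in auto)
  then obtain f where f': "\<forall>n. f n \<in> \<F> \<and> f n \<subset> f (Suc n)" ..
  then have f: "f n \<in> \<F>" "f n \<subset> f (Suc n)" for n by auto
  have mono: "i \<le> j \<Longrightarrow> f i \<subseteq> f j" for i j
    by (rule lift_Suc_mono_le[of f]) (simp_all add: f(2) psubset_imp_subset)
  obtain F where F: "F \<subseteq> \<Union>(range f)" "finite F" "\<Union>(range f) \<subseteq> lspan UNIV F"
    using n[unfolded noetherian_def, rule_format, OF subset_UNIV] by blast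
  have "\<forall>x\<in>F. \<exists>i. x \<in> f i" using F by auto
  then obtain g where g: "\<And>x. x \<in> F \<Longrightarrow> x \<in> f (g x)" by metis
  define m where "m = Max (insert 0 (g ` F))"
  have "g x \<le> m" if "x \<in> F" for x unfolding m_def using F that by (intro Max_ge) auto
  then have "F \<subseteq> f m" using g mono by blast
  then have "lspan UNIV F \<subseteq> f m" using lspan_ideal[OF id[OF f(1)]] by auto
  then have "f (Suc m) \<subseteq> f m" using F(3) by blast
  then show False using f(2)[of m] by simp
qed

text \<open>A maximal element among the ideals \<open>(I : h f)\<close> that avoid \<open>S\<close> is prime.\<close>

lemma exists_associated_prime:
  fixes I :: "'a::comm_ring_1 set"
  assumes n: "noetherian (UNIV :: 'a set)" and I: "is_ideal I"
    and S1: "1 \<in> S" and Sm: "\<And>a b. a \<in> S \<Longrightarrow> b \<in> S \<Longrightarrow> a * b \<in> S"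
    and f: "\<And>s. s \<in> S \<Longrightarrow> s * f \<notin> I"
  shows "\<exists>h. is_prime {g. g * (h * f) \<in> I} \<and> S \<inter> {g. g * (h * f) \<in> I} = {}"
proof -
  define K where "K h = {g. g * (h * f) \<in> I}" for h
  have K_iff: "g \<in> K h \<longleftrightarrow> g * (h * f) \<in> I" for g h by (simp add: K_def)
  define \<F> where "\<F> = K ` {h. S \<inter> K h = {}}"
  have "1 \<in> {h. S \<inter> K h = {}}" using f by (auto simp: K_iff)
  then have "\<F> \<noteq> {}" unfolding \<F>_def by blast
  then have "\<exists>J\<in>\<F>. \<forall>L\<in>\<F>. J \<subseteq> L \<longrightarrow> L = J"
    by (rule noetherian_maximal[OF n]) (auto simp: \<F>_def K_def is_ideal_colon[OF I])
  then obtain h where h: "S \<inter> K h = {}"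
    and max: "\<And>h'. S \<inter> K h' = {} \<Longrightarrow> K h \<subseteq> K h' \<Longrightarrow> K h' = K h"
    by (auto simp: \<F>_def)
  have incl: "K h \<subseteq> K (a * h)" for a
    using is_ideal_mult[OF I, of "_ * (h * f)" a] by (auto simp: K_iff ac_simps)
  have "is_prime (K h)" unfolding is_prime_def
  proof (intro conjI allI impI)
    show "is_ideal (K h)" unfolding K_def by (rule is_ideal_colon[OF I])
    show "1 \<notin> K h" using S1 h by blast
    fix a b assume ab: "a * b \<in> K h"
    show "a \<in> K h \<or> b \<in> K h"
    proof (rule ccontr)
      assume c: "\<not> ?thesis"
      moreover have "b \<in> K (a * h)" using ab by (simp add: K_iff ac_simps)
      ultimately have "K (a * h) \<noteq> K h" by auto
      \<comment> \<open>Maximality forces \<open>S\<close> to meet the strictly larger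
        \<open>K (a * h)\<close>. Multiplying \<open>h\<close> by an element \<open>v\<close> found
        there creates no new meeting with \<open>S\<close>, so \<open>K (v * h) = K h\<close>, and
        the former contains \<open>a\<close>.\<close>
      then obtain v where v: "v \<in> S" "v \<in> K (a * h)" using max[OF _ incl, of a] by blast
      have "S \<inter> K (v * h) = {}"
      proof (rule ccontr)
        assume "S \<inter> K (v * h) \<noteq> {}"
        then obtain w where "w \<in> S" "w * v \<in> K h" by (auto simp: K_iff algebra_simps)
        then show False using Sm[OF _ v(1), of w] h by auto
      qed
      then have "K (v * h) = K h" using max[OF _ incl, of v] by blast
      moreover have "a \<in> K (v * h)" using v(2) by (simp add: K_iff algebra_simps)
      ultimately show False using c by auto
    qed
  qed
  then show ?thesis using h unfolding K_def by auto
qed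

text \<open>In a maximal counterexample \<open>K\<close> some \<open>a * b \<in> K\<close> has both
  factors outside \<open>K\<close>; the primes over \<open>K\<close> are those over
  \<open>K + (a)\<close> together with those over \<open>K + (b)\<close>, and both of these larger
  ideals have finite families.\<close>

lemma finitely_many_minimal_primes:
  fixes J :: "'a::comm_ring_1 set"
  assumes n: "noetherian (UNIV :: 'a set)" and J: "is_ideal J"
  shows "\<exists>\<P>. finite \<P> \<and> (\<forall>P\<in>\<P>. is_prime P \<and> J \<subseteq> P) \<and>
    (\<forall>Q. is_prime Q \<longrightarrow> J \<subseteq> Q \<longrightarrow> (\<exists>P\<in>\<P>. P \<subseteq> Q))"
proof (rule ccontr)
  define T where "T J \<P> \<longleftrightarrow> finite \<P> \<and> (\<forall>P\<in>\<P>. is_prime P \<and> J \<subseteq> P) \<and>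
    (\<forall>Q. is_prime Q \<longrightarrow> J \<subseteq> Q \<longrightarrow> (\<exists>P\<in>\<P>. P \<subseteq> Q))" for J :: "'a set" and \<P>
  define \<F> where "\<F> = {J. is_ideal J \<and> \<not> (\<exists>\<P>. T J \<P>)}"
  assume "\<not> ?thesis"
  then have "J \<in> \<F>" using J by (simp add: \<F>_def T_def)
  then have "\<exists>K\<in>\<F>. \<forall>L\<in>\<F>. K \<subseteq> L \<longrightarrow> L = K"
    by (intro noetherian_maximal[OF n]) (auto simp: \<F>_def)
  then obtain K where "K \<in> \<F>" and K_max: "\<And>L. L \<in> \<F> \<Longrightarrow> K \<subseteq> L \<Longrightarrow> L = K" by metis
  then have K: "is_ideal K" "\<And>\<P>. \<not> T K \<P>" by (auto simp: \<F>_def)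
  have "\<not> is_prime K" using K(2)[of "{K}"] by (auto simp: T_def)
  moreover have "1 \<notin> K" using K(2)[of "{}"] is_ideal_one[OF K(1)] by (auto simp: T_def is_prime_def)
  ultimately obtain a b where ab: "a * b \<in> K" "a \<notin> K" "b \<notin> K"
    using K(1) by (auto simp: is_prime_def)
  define E where "E c = lspan UNIV (insert c K)" for c
  have E: "K \<subseteq> E c" "c \<in> E c" "is_ideal (E c)" for c
    by (auto simp: E_def is_ideal_lspan intro: lspan_base ring_closed_UNIV)
  have E_le: "E c \<subseteq> L" if "is_prime L" "K \<subseteq> L" "c \<in> L" for c L
    unfolding E_def using that by (intro lspan_ideal is_prime_ideal) auto
  have ex: "\<exists>\<P>. T (E c) \<P>" if "c \<notin> K" for c
  proof (rule ccontr)
    assume "\<not> ?thesis"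
    then have "E c \<in> \<F>" using E(3) by (simp add: \<F>_def)
    then show False using K_max[OF _ E(1)] E(2)[of c] that by simp
  qed
  obtain \<P> \<Q> where PQ: "T (E a) \<P>" "T (E b) \<Q>" using ex ab by metis
  have prime: "is_prime P \<and> K \<subseteq> P" if "P \<in> \<P> \<union> \<Q>" for P
    using that PQ E(1)[of a] E(1)[of b] unfolding T_def by (meson Un_iff order_trans)
  have below: "\<exists>P\<in>\<P> \<union> \<Q>. P \<subseteq> L" if L: "is_prime L" "K \<subseteq> L" for L
  proof -
    have "a \<in> L \<or> b \<in> L" using ab(1) L is_prime_mult by auto
    then have "E a \<subseteq> L \<or> E b \<subseteq> L" using E_le[OF L] by auto
    then show ?thesis using L(1) PQ unfolding T_def by (meson Un_iff)
  qed
  have "T K (\<P> \<union> \<Q>)" using PQ prime below by (simp add: T_def)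
  then show False using K(2) by simp
qed

section \<open>Homogeneous ideals and their powers\<close>

lemma ideal_ring_of_type_algebra_iff:
  "ideal J (ring_of_type_algebra :: 'a::comm_ring_1 ring) \<longleftrightarrow> is_ideal J"
proof
  let ?R = "ring_of_type_algebra :: 'a ring"
  interpret R: ring ?R by (rule ring_from_type_algebra)
  have ops: "carrier ?R = UNIV" "\<And>x y. x \<oplus>\<^bsub>?R\<^esub> y = x + y" "\<And>x y. x \<otimes>\<^bsub>?R\<^esub> y = x * y" "\<zero>\<^bsub>?R\<^esub> = 0"
    by (simp_all add: ring_of_type_algebra_def)
  { assume "ideal J ?R"
    then interpret J: ideal J ?R .
    show "is_ideal J" unfolding is_ideal_def
      using J.zero_closed J.a_closed J.I_l_closed by (auto simp: ops) }
  assume J: "is_ideal J"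
  show "ideal J ?R"
  proof (rule idealI)
    show "subgroup J (add_monoid ?R)"
    proof (rule R.add.subgroupI)
      show "J \<noteq> {}" using is_ideal_zero[OF J] by auto
      fix x y assume x: "x \<in> J" and y: "y \<in> J"
      show "x \<oplus>\<^bsub>?R\<^esub> y \<in> J" using is_ideal_add[OF J x y] by (simp add: ops)
      have "\<ominus>\<^bsub>?R\<^esub> x = - x" by (rule R.minus_equality) (auto simp: ops)
      then show "\<ominus>\<^bsub>?R\<^esub> x \<in> J" using is_ideal_uminus[OF J x] by simp
    qed (simp add: ops)
  qed (use R.ring_axioms J in \<open>auto simp: ops intro: is_ideal_mult is_ideal_mult_right\<close>)
qed

lemma primeideal_ring_of_type_algebra_iff:
  "primeideal P (ring_of_type_algebra :: 'a::comm_ring_1 ring) \<longleftrightarrow> is_prime P"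
proof
  let ?R = "ring_of_type_algebra :: 'a ring"
  have ops: "carrier ?R = UNIV" "\<And>x y. x \<otimes>\<^bsub>?R\<^esub> y = x * y"
    by (simp_all add: ring_of_type_algebra_def)
  { assume "primeideal P ?R"
    then interpret P: primeideal P ?R .
    have P: "is_ideal P" using P.is_ideal by (simp add: ideal_ring_of_type_algebra_iff)
    then show "is_prime P"
      using P.I_prime P.I_notcarr is_ideal_one[OF P] by (auto simp: is_prime_def ops) }
  assume "is_prime P"
  then show "primeideal P ?R"
    by (intro primeidealI cring_from_type_algebra)
      (auto simp: ideal_ring_of_type_algebra_iff ops is_prime_def)
qed

lemma genideal_ring_of_type_algebra:
  "Idl\<^bsub>ring_of_type_algebra :: 'a::comm_ring_1 ring\<^esub> Z = lspan UNIV Z"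
proof
  show "Idl\<^bsub>ring_of_type_algebra :: 'a ring\<^esub> Z \<subseteq> lspan UNIV Z"
    unfolding genideal_def ideal_ring_of_type_algebra_iff
    using is_ideal_lspan[of Z] lspan_base[OF ring_closed_UNIV, of _ Z] by blast
  show "lspan UNIV Z \<subseteq> Idl\<^bsub>ring_of_type_algebra :: 'a ring\<^esub> Z"
    unfolding genideal_def ideal_ring_of_type_algebra_iff
    using lspan_ideal[of _ Z UNIV] by blast
qed

lemma ideal_power_0: "ideal_power I 0 = UNIV"
  by (simp add: ideal_power_def nat_pow_def ideals_set_def ring_of_type_algebra_def)

lemma ideal_power_Suc: "ideal_power I (Suc m) = ideal_prod poly_ring (ideal_power I m) I"
  by (simp add: ideal_power_def nat_pow_def ideals_set_def)

lemma ideal_power_Suc_mult: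
  "u \<in> ideal_power I m \<Longrightarrow> v \<in> I \<Longrightarrow> u * v \<in> ideal_power I (Suc m)"
  unfolding ideal_power_Suc using ideal_prod.prod[of u "ideal_power I m" v I poly_ring]
  by (simp add: ring_of_type_algebra_def)

lemma ideal_power_Suc_induct [consumes 1, case_names mult add]:
  assumes "x \<in> ideal_power I (Suc m)"
    and "\<And>u v. u \<in> ideal_power I m \<Longrightarrow> v \<in> I \<Longrightarrow> P (u * v)"
    and "\<And>x y. P x \<Longrightarrow> P y \<Longrightarrow> P (x + y)"
  shows "P x"
  using assms(1) unfolding ideal_power_Suc
  by induction (use assms(2,3) in \<open>auto simp: ring_of_type_algebra_def\<close>)

lemma is_ideal_ideal_power:
  assumes "is_ideal I"
  shows "is_ideal (ideal_power I m)"
proof (induction m)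
  case 0
  show ?case by (simp add: ideal_power_0 is_ideal_def)
next
  case (Suc m)
  interpret R: ring poly_ring by (rule ring_from_type_algebra)
  show ?case using Suc assms R.ideal_prod_is_ideal
    by (simp add: ideal_power_Suc flip: ideal_ring_of_type_algebra_iff)
qed

lemma ideal_power_mult:
  assumes I: "is_ideal I" and u: "u \<in> ideal_power I m" and v: "v \<in> ideal_power I k"
  shows "u * v \<in> ideal_power I (m + k)"
  using v
proof (induction k arbitrary: v)
  case 0
  then show ?case using is_ideal_mult_right[OF is_ideal_ideal_power[OF I] u] by simp
next
  case (Suc k)
  from Suc.prems show ?case
  proof (induction rule: ideal_power_Suc_induct)
    case (mult w v)
    then show ?case
      using ideal_power_Suc_mult[OF Suc.IH[OF mult(1)] mult(2)] by (simp add: mult.assoc)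
  next
    case (add x y)
    then show ?case
      using is_ideal_add[OF is_ideal_ideal_power[OF I]] by (simp add: distrib_left)
  qed
qed

lemma ideal_power_one:
  assumes I: "is_ideal I"
  shows "ideal_power I 1 = I"
proof
  show "I \<subseteq> ideal_power I 1"
    using ideal_power_Suc_mult[of 1 I 0] by (auto simp: ideal_power_0)
  show "ideal_power I 1 \<subseteq> I"
  proof
    fix x assume "x \<in> ideal_power I 1"
    then have "x \<in> ideal_power I (Suc 0)" by simp
    then show "x \<in> I"
      by (induction rule: ideal_power_Suc_induct) (use I in \<open>auto intro: is_ideal_mult is_ideal_add\<close>)
  qed
qed

lemma ideal_power_antimono:
  assumes I: "is_ideal I" and "r \<le> m"
  shows "ideal_power I m \<subseteq> ideal_power I r"
  using assms(2)
proof (induction rule: dec_induct)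
  case (step m)
  have "x \<in> ideal_power I m" if "x \<in> ideal_power I (Suc m)" for x
    using that by (induction rule: ideal_power_Suc_induct)
      (auto intro: is_ideal_mult_right is_ideal_add is_ideal_ideal_power[OF I])
  then show ?case using step by blast
qed simp

lemma associated_primes_eq: "associated_primes I = {P. is_prime P \<and> (\<exists>f. P = {g. g * f \<in> I})}"
  by (simp add: associated_primes_def primeideal_ring_of_type_algebra_iff)

section \<open>Monomials, homogeneous components and graded sets\<close>

lemma poly_mapping_sum_single:
  assumes "finite S" "Poly_Mapping.keys f \<subseteq> S"
  shows "(\<Sum>a\<in>S. Poly_Mapping.single a (Poly_Mapping.lookup f a)) = f"
proof (rule poly_mapping_eqI)
  fix a
  have "Poly_Mapping.lookup (\<Sum>a\<in>S. Poly_Mapping.single a (Poly_Mapping.lookup f a)) a =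
    (\<Sum>b\<in>S. if b = a then Poly_Mapping.lookup f b else 0)"
    unfolding lookup_sum by (intro sum.cong) (auto simp: lookup_single when_def)
  also have "\<dots> = Poly_Mapping.lookup f a" using assms by (auto simp: in_keys_iff)
  finally show "Poly_Mapping.lookup (\<Sum>a\<in>S. Poly_Mapping.single a (Poly_Mapping.lookup f a)) a =
    Poly_Mapping.lookup f a" .
qed

lemma mon_degree_0 [simp]: "mon_degree 0 = 0"
  by (simp add: mon_degree_def)

lemma mon_degree_add: "mon_degree (a + b) = mon_degree a + mon_degree b"
  by (simp add: mon_degree_def lookup_add sum.distrib)

definition hcomp :: "nat \<Rightarrow> ('n::finite, 'k::field) mpoly \<Rightarrow> ('n, 'k) mpoly" where
  "hcomp t f = Poly_Mapping.mapp (\<lambda>a c. if mon_degree a = t then c else 0) f"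

lemma lookup_hcomp:
  "Poly_Mapping.lookup (hcomp t f) a = (if mon_degree a = t then Poly_Mapping.lookup f a else 0)"
  by (auto simp: hcomp_def lookup_mapp when_def in_keys_iff)

lemma hcomp_0 [simp]: "hcomp t 0 = 0"
  and hcomp_add: "hcomp t (f + g) = hcomp t f + hcomp t g"
  and hcomp_diff: "hcomp t (f - g) = hcomp t f - hcomp t g"
  by (auto intro!: poly_mapping_eqI simp: lookup_hcomp lookup_add lookup_minus)

lemma hcomp_sum: "hcomp t (sum f S) = (\<Sum>i\<in>S. hcomp t (f i))"
  by (induction S rule: infinite_finite_induct) (auto simp: hcomp_add)

lemma form_hcomp: "form t (hcomp t f)"
  by (auto simp: form_def in_keys_iff lookup_hcomp split: if_splits)

lemma hcomp_form: "form d f \<Longrightarrow> hcomp t f = (if t = d then f else 0)"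
  by (rule poly_mapping_eqI) (auto simp: lookup_hcomp form_def in_keys_iff)

lemma form_0 [simp]: "form t 0"
  by (simp add: form_def)

lemma form_1: "form 0 1"
  by (auto simp: form_def in_keys_iff lookup_one when_def split: if_splits)

lemma form_add: "form t f \<Longrightarrow> form t g \<Longrightarrow> form t (f + g)"
  using keys_add[of f g] by (auto simp: form_def)

lemma form_mult: "form t f \<Longrightarrow> form s g \<Longrightarrow> form (t + s) (f * g)"
  using keys_mult[of f g] by (fastforce simp: form_def mon_degree_add)

lemma form_power: "form t f \<Longrightarrow> form (t * n) (f ^ n)"
  by (induction n) (auto simp: form_1 intro: form_mult)

lemma sum_hcomp:
  assumes "finite S" "mon_degree ` Poly_Mapping.keys f \<subseteq> S"
  shows "(\<Sum>t\<in>S. hcomp t f) = f"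
proof (rule poly_mapping_eqI)
  fix a
  have "Poly_Mapping.lookup (\<Sum>t\<in>S. hcomp t f) a =
    (\<Sum>t\<in>S. if t = mon_degree a then Poly_Mapping.lookup f a else 0)"
    unfolding lookup_sum by (intro sum.cong) (auto simp: lookup_hcomp)
  also have "\<dots> = Poly_Mapping.lookup f a" using assms by (auto simp: in_keys_iff image_subset_iff)
  finally show "Poly_Mapping.lookup (\<Sum>t\<in>S. hcomp t f) a = Poly_Mapping.lookup f a" .
qed

lemma hcomp_eq_0: "t \<notin> mon_degree ` Poly_Mapping.keys f \<Longrightarrow> hcomp t f = 0"
  by (rule poly_mapping_eqI) (auto simp: lookup_hcomp in_keys_iff)

lemma obtain_sum_hcomp:
  fixes f :: "('n::finite, 'k::field) mpoly"
  obtains S where "finite S" "(\<Sum>t\<in>S. hcomp t f) = f" "\<And>t. t \<notin> S \<Longrightarrow> hcomp t f = 0"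
  by (rule that[of "mon_degree ` Poly_Mapping.keys f"]) (auto intro: sum_hcomp hcomp_eq_0)

lemma hcomp_mult_form:
  assumes "form d g"
  shows "hcomp t (f * g) = (if d \<le> t then hcomp (t - d) f * g else 0)"
proof -
  obtain S where S: "finite S" "(\<Sum>t\<in>S. hcomp t f) = f" "\<And>t. t \<notin> S \<Longrightarrow> hcomp t f = 0"
    by (rule obtain_sum_hcomp[of f]) blast
  have "hcomp t (f * g) = (\<Sum>s\<in>S. hcomp t (hcomp s f * g))"
    by (subst S(2)[symmetric]) (simp add: sum_distrib_right hcomp_sum)
  also have "\<dots> = (\<Sum>s\<in>S. if s + d = t then hcomp s f * g else 0)"
    by (intro sum.cong) (auto simp: hcomp_form[OF form_mult[OF form_hcomp assms]])
  also have "\<dots> = (\<Sum>s\<in>S. if s = t - d \<and> d \<le> t then hcomp s f * g else 0)"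
    by (intro sum.cong) auto
  also have "\<dots> = (if d \<le> t then hcomp (t - d) f * g else 0)"
    using S(1,3) by (cases "d \<le> t") auto
  finally show ?thesis .
qed

lemma hcomp_mult: "hcomp t (f * g) = (\<Sum>s\<le>t. hcomp s f * hcomp (t - s) g)"
proof -
  obtain S where S: "finite S" "(\<Sum>t\<in>S. hcomp t g) = g" "\<And>t. t \<notin> S \<Longrightarrow> hcomp t g = 0"
    by (rule obtain_sum_hcomp[of g]) blast
  have "hcomp t (f * g) = (\<Sum>d\<in>S. hcomp t (f * hcomp d g))"
    by (subst S(2)[symmetric]) (simp add: sum_distrib_left hcomp_sum)
  also have "\<dots> = (\<Sum>d\<in>S. if d \<le> t then hcomp (t - d) f * hcomp d g else 0)"
    by (intro sum.cong) (auto simp: hcomp_mult_form[OF form_hcomp])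
  also have "\<dots> = (\<Sum>d\<in>S \<inter> {..t}. hcomp (t - d) f * hcomp d g)"
    using S(1) by (simp add: sum.inter_restrict)
  also have "\<dots> = (\<Sum>d\<le>t. hcomp (t - d) f * hcomp d g)"
  proof (rule sum.mono_neutral_left)
    show "\<forall>d\<in>{..t} - S \<inter> {..t}. hcomp (t - d) f * hcomp d g = 0"
    proof
      fix d assume "d \<in> {..t} - S \<inter> {..t}"
      then have "d \<notin> S" by blast
      then show "hcomp (t - d) f * hcomp d g = 0" using S(3) by simp
    qed
  qed auto
  also have "\<dots> = (\<Sum>s\<le>t. hcomp s f * hcomp (t - s) g)"
    by (rule sum.reindex_bij_witness[of _ "\<lambda>s. t - s" "\<lambda>s. t - s"]) auto
  finally show ?thesis .
qed

text \<open>Stated for arbitrary sets, so that it can be applied to symbolic powers and saturations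
  directly. For ideals it is homogeneity, by \<open>homogeneous_ideal_iff\<close>.\<close>

definition graded :: "('n::finite, 'k::field) mpoly set \<Rightarrow> bool" where
  "graded J \<longleftrightarrow> (\<forall>f\<in>J. \<forall>t. hcomp t f \<in> J)"

lemma gradedD: "graded J \<Longrightarrow> f \<in> J \<Longrightarrow> hcomp t f \<in> J"
  by (auto simp: graded_def)

lemma graded_lspan_forms:
  assumes "\<And>g. g \<in> Z \<Longrightarrow> \<exists>d. form d g"
  shows "graded (lspan UNIV Z)"
  unfolding graded_def
proof (intro ballI allI)
  fix f t assume "f \<in> lspan UNIV Z"
  then show "hcomp t f \<in> lspan UNIV Z"
  proof induction
    case (step a x y)
    obtain d where "form d x" using assms step by blast
    then show ?case using step
      by (auto simp: hcomp_add hcomp_mult_form intro: lspan.step)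
  qed (simp add: lspan.zero)
qed

lemma homogeneous_ideal_iff: "homogeneous_ideal I \<longleftrightarrow> is_ideal I \<and> graded I"
proof
  assume "homogeneous_ideal I"
  then have I: "is_ideal I" "I = lspan UNIV {f \<in> I. \<exists>t. form t f}"
    by (auto simp: homogeneous_ideal_def ideal_ring_of_type_algebra_iff genideal_ring_of_type_algebra)
  have "graded (lspan UNIV {f \<in> I. \<exists>t. form t f})" by (rule graded_lspan_forms) auto
  then show "is_ideal I \<and> graded I" using I by simp
next
  assume I: "is_ideal I \<and> graded I"
  have "f \<in> lspan UNIV {f \<in> I. \<exists>t. form t f}" if f: "f \<in> I" for f
  proof -
    obtain S where S: "finite S" "(\<Sum>t\<in>S. hcomp t f) = f" by (rule obtain_sum_hcomp[of f])
    have "hcomp t f \<in> lspan UNIV {f \<in> I. \<exists>t. form t f}" for t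
      using gradedD[of I f t] I f form_hcomp[of t f] by (intro lspan_base[OF ring_closed_UNIV]) auto
    then have "(\<Sum>t\<in>S. hcomp t f) \<in> lspan UNIV {f \<in> I. \<exists>t. form t f}"
      by (intro is_ideal_sum is_ideal_lspan)
    then show ?thesis using S by simp
  qed
  moreover have "lspan UNIV {f \<in> I. \<exists>t. form t f} \<subseteq> I" using I by (intro lspan_ideal) auto
  ultimately show "homogeneous_ideal I" using I
    by (auto simp: homogeneous_ideal_def ideal_ring_of_type_algebra_iff genideal_ring_of_type_algebra)
qed

lemma graded_ideal_power:
  assumes I: "is_ideal I" "graded I"
  shows "graded (ideal_power I m)"
proof (induction m)
  case 0
  show ?case by (simp add: ideal_power_0 graded_def)
next
  case (Suc m)
  have "hcomp t x \<in> ideal_power I (Suc m)" if "x \<in> ideal_power I (Suc m)" for t x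
    using that
  proof (induction rule: ideal_power_Suc_induct)
    case (mult u v)
    then show ?case unfolding hcomp_mult
      by (intro is_ideal_sum is_ideal_ideal_power I ideal_power_Suc_mult gradedD[OF Suc] gradedD[OF I(2)])
  next
    case (add x y)
    then show ?case unfolding hcomp_add by (intro is_ideal_add is_ideal_ideal_power I)
  qed
  then show ?case by (simp add: graded_def)
qed

text \<open>Multiplying the witness \<open>f\<close> of an associated prime \<open>P\<close> by an element outside \<open>P\<close>
  does not change its annihilator; this lets one shorten \<open>f\<close> modulo \<open>I\<close>.\<close>

lemma graded_associated_prime:
  assumes I: "is_ideal I" "graded I" and P: "is_prime P" "P = {g. g * f \<in> I}"
  shows "graded P"
  using P(2)
proof (induction "card {t. hcomp t f \<notin> I}" arbitrary: f rule: less_induct)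
  case less
  let ?D = "\<lambda>f. {t. hcomp t f \<notin> I}"
  have fin: "finite (?D f)" for f
  proof -
    obtain S where "finite S" "\<And>t. t \<notin> S \<Longrightarrow> hcomp t f = 0" by (rule obtain_sum_hcomp[of f]) blast
    then have "t \<in> S" if "hcomp t f \<notin> I" for t
      using that is_ideal_zero[OF I(1)] by (cases "t \<in> S") auto
    then have "?D f \<subseteq> S" by auto
    then show ?thesis using \<open>finite S\<close> by (rule finite_subset)
  qed
  have "?D f \<noteq> {}"
  proof
    assume "?D f = {}"
    obtain S where S: "(\<Sum>t\<in>S. hcomp t f) = f" by (rule obtain_sum_hcomp[of f])
    have "(\<Sum>t\<in>S. hcomp t f) \<in> I" using \<open>?D f = {}\<close> by (intro is_ideal_sum I) auto
    then have "f \<in> I" using S by simp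
    then show False using is_prime_one[OF P(1)] less.prems by simp
  qed
  define e where "e = Max (?D f)"
  have e: "e \<in> ?D f" unfolding e_def by (rule Max_in[OF fin \<open>?D f \<noteq> {}\<close>])
  have above_e: "hcomp t f \<in> I" if "t > e" for t
    using that Max_ge[OF fin, of t f] unfolding e_def by fastforce
  \<comment> \<open>If the top component of \<open>g\<close> were outside \<open>P\<close>, then
    \<open>hcomp d g * f\<close> would have the same annihilator \<open>P\<close> modulo
    \<open>I\<close> but fewer components outside \<open>I\<close>. The induction hypothesis would
    make \<open>P\<close> graded, a contradiction.\<close>
  have top: "hcomp d g \<in> P" if g: "g \<in> P" and above: "\<And>t. t > d \<Longrightarrow> hcomp t g = 0" for g d
  proof (rule ccontr)
    assume nd: "hcomp d g \<notin> P"
    let ?f = "hcomp d g * f"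
    have Pf: "P = {h. h * ?f \<in> I}"
    proof -
      have "h * ?f \<in> I \<longleftrightarrow> h * hcomp d g \<in> P" for h using less.prems by (simp add: mult.assoc)
      then show ?thesis
        using is_prime_mult[OF P(1)] nd is_ideal_mult_right[OF is_prime_ideal[OF P(1)]] by auto
    qed
    have comp: "hcomp t ?f = (if d \<le> t then hcomp d g * hcomp (t - d) f else 0)" for t
      using hcomp_mult_form[OF form_hcomp, of t f d g] by (simp add: mult.commute)
    \<comment> \<open>Modulo \<open>I\<close> only the product of the two top components survives in
      degree \<open>d + e\<close>: for \<open>s > d\<close> the component of \<open>g\<close>
      vanishes, for \<open>s < d\<close> that of \<open>f\<close> has degree above
      \<open>e\<close>.\<close>
    have "hcomp (d + e) (g * f) = hcomp d g * hcomp e f +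
      (\<Sum>s\<in>{..d + e} - {d}. hcomp s g * hcomp (d + e - s) f)"
      unfolding hcomp_mult by (subst sum.remove[of _ d]) auto
    moreover have "(\<Sum>s\<in>{..d + e} - {d}. hcomp s g * hcomp (d + e - s) f) \<in> I"
    proof (intro is_ideal_sum I)
      fix s assume "s \<in> {..d + e} - {d}"
      then show "hcomp s g * hcomp (d + e - s) f \<in> I"
        using above[of s] above_e[of "d + e - s"] is_ideal_zero[OF I(1)] is_ideal_mult[OF I(1)]
        by (cases "s < d") auto
    qed
    moreover have "hcomp (d + e) (g * f) \<in> I" using g less.prems gradedD[OF I(2)] by auto
    ultimately have "hcomp d g * hcomp e f \<in> I"
      using is_ideal_diff[OF I(1), of "hcomp (d + e) (g * f)"] by fastforce
    then have "?D ?f \<subseteq> (+) d ` (?D f - {e})"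
    proof (intro subsetI)
      fix t assume "t \<in> ?D ?f"
      then have "d \<le> t" "hcomp d g * hcomp (t - d) f \<notin> I"
        using is_ideal_zero[OF I(1)] by (auto simp: comp split: if_splits)
      moreover from this have "t - d \<in> ?D f" using is_ideal_mult[OF I(1)] by blast
      ultimately show "t \<in> (+) d ` (?D f - {e})"
        using \<open>hcomp d g * hcomp e f \<in> I\<close> by (intro image_eqI[of _ _ "t - d"]) auto
    qed
    then have "card (?D ?f) \<le> card (?D f - {e})"
      using fin by (intro surj_card_le) auto
    also have "\<dots> < card (?D f)" using e fin by (intro psubset_card_mono) auto
    finally have "graded P" using less.hyps[of ?f] Pf by blast
    then show False using nd g by (auto dest: gradedD)
  qed
  show ?case unfolding graded_def
  proof (intro ballI)
    fix g assume "g \<in> P"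
    obtain S where "finite S" "\<And>t. t \<notin> S \<Longrightarrow> hcomp t g = 0" by (rule obtain_sum_hcomp[of g]) blast
    moreover from this obtain n where "\<forall>t\<in>S. t < n" using finite_nat_set_iff_bounded by blast
    ultimately have "\<forall>t\<ge>n. hcomp t g = 0" by (metis not_le)
    with \<open>g \<in> P\<close> show "\<forall>t. hcomp t g \<in> P"
    \<comment> \<open>Induction on a strict degree bound: \<open>top\<close> places the top
      component in \<open>P\<close>, and subtracting it lowers the bound.\<close>
    proof (induction n arbitrary: g)
      case 0
      then show ?case using is_ideal_zero[OF is_prime_ideal[OF P(1)]] by simp
    next
      case (Suc n)
      have n: "hcomp n g \<in> P" using Suc.prems by (intro top) auto
      have g': "g - hcomp n g \<in> P" using is_ideal_diff[OF is_prime_ideal[OF P(1)]] Suc.prems n by blast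
      have "hcomp t (g - hcomp n g) = 0" if "t \<ge> n" for t
        using Suc.prems(2) that hcomp_form[OF form_hcomp, of t n g] by (cases "t = n") (auto simp: hcomp_diff)
      then have "\<forall>t. hcomp t (g - hcomp n g) \<in> P" using Suc.IH g' by blast
      then have "hcomp t (g - hcomp n g) + hcomp t (hcomp n g) \<in> P" for t
        using n is_ideal_zero[OF is_prime_ideal[OF P(1)]]
        by (intro is_ideal_add[OF is_prime_ideal[OF P(1)]]) (auto simp: hcomp_form[OF form_hcomp])
      then show ?case by (simp add: hcomp_diff)
    qed
  qed
qed

section \<open>The polynomial ring is Noetherian\<close>

lemma noetherian_field: "noetherian (UNIV :: 'k::field set)"
  unfolding noetherian_def
proof (intro allI impI)
  fix Z :: "'k set"
  show "\<exists>F\<subseteq>Z. finite F \<and> Z \<subseteq> lspan UNIV F"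
  proof (cases "Z \<subseteq> {0}")
    case True
    then show ?thesis by (intro exI[of _ "{}"]) (auto intro: lspan.zero)
  next
    case False
    then obtain x where x: "x \<in> Z" "x \<noteq> 0" by auto
    have "y \<in> lspan UNIV {x}" for y
      using lspan.step[of "y / x" UNIV x "{x}" 0] x by (simp add: lspan.zero)
    then show ?thesis using x by (intro exI[of _ "{x}"]) auto
  qed
qed

definition var :: "'n \<Rightarrow> ('n::finite, 'k::field) mpoly" where
  "var i = Poly_Mapping.single (Poly_Mapping.single i 1) 1"

lemma var_power: "var i ^ n = Poly_Mapping.single (Poly_Mapping.single i n) 1"
  by (induction n) (simp_all add: var_def mult_single flip: single_add)

lemma prod_single: "(\<Prod>i\<in>S. Poly_Mapping.single (a i) 1) =
    (Poly_Mapping.single (\<Sum>i\<in>S. a i) 1 :: ('n::finite, 'k::field) mpoly)"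
  by (induction S rule: infinite_finite_induct) (simp_all add: mult_single)

lemma single_eq_prod_var:
  "Poly_Mapping.single a c = Poly_Mapping.single 0 c * (\<Prod>i\<in>UNIV. (var i :: ('n::finite, 'k::field) mpoly) ^ Poly_Mapping.lookup a i)"
  by (simp add: var_power prod_single poly_mapping_sum_single mult_single)

lemma form_var: "form 1 (var i)"
  by (auto simp: form_def var_def mon_degree_def lookup_single when_def)

lemma prod_closed: "ring_closed A \<Longrightarrow> (\<And>i. i \<in> S \<Longrightarrow> f i \<in> A) \<Longrightarrow> prod f S \<in> A"
  by (induction S rule: infinite_finite_induct) (auto simp: ring_closed_def)

text \<open>The constants are a copy of the field, and adjoining the finitely many variables to them
  already gives every monomial.\<close>

theorem noetherian_mpoly: "noetherian (UNIV :: ('n::finite, 'k::field) mpoly set)"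
proof -
  let ?c = "Poly_Mapping.single 0 :: 'k \<Rightarrow> ('n, 'k) mpoly"
  have "noetherian (range ?c)"
    by (rule noetherian_image[OF ring_closed_UNIV noetherian_field]) (auto simp: single_add mult_single)
  moreover have "ring_closed (range ?c)" unfolding ring_closed_def
    using image_eqI[of 0 ?c 0 UNIV]
    by (auto simp: mult_single simp flip: single_add single_diff single_one)
  ultimately obtain C where C: "ring_closed C" "noetherian C" "range ?c \<union> range var \<subseteq> C"
    using noetherian_adjoin[of "range ?c" "range var"] by auto
  have "Poly_Mapping.single a c \<in> C" for a :: "'n \<Rightarrow>\<^sub>0 nat" and c
  proof -
    have "(\<Prod>i\<in>UNIV. var i ^ Poly_Mapping.lookup a i) \<in> C"
      using C by (intro prod_closed ring_closed_power) auto
    then show ?thesis unfolding single_eq_prod_var[of a c] using C by (auto simp: ring_closed_def)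
  qed
  then have "(\<Sum>a\<in>Poly_Mapping.keys f. Poly_Mapping.single a (Poly_Mapping.lookup f a)) \<in> C" for f
    by (intro sum_closed[OF C(1)])
  then have "C = UNIV" by (auto simp: poly_mapping_sum_single)
  then show ?thesis using C by simp
qed

section \<open>Elements of symbolic powers\<close>

text \<open>The fractions with numerator in \<open>J\<close> form an ideal of the localization;
  conversely \<open>f\<close> is \<open>1/s\<close> times \<open>s * f\<close>. After this,
  fractions are replaced by a single multiplier \<open>s\<close>.\<close>

lemma localization_ideal_iff:
  fixes A J :: "'a::idom set"
  assumes A: "1 \<in> A" "0 \<notin> A" "\<And>a b. a \<in> A \<Longrightarrow> b \<in> A \<Longrightarrow> a * b \<in> A" and J: "is_ideal J"
  shows "Fraction_Field.Fract f 1 \<in> Idl\<^bsub>localization A\<^esub> ((\<lambda>f. Fraction_Field.Fract f 1) ` J) \<longleftrightarrow>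
    (\<exists>s\<in>A. s * f \<in> J)"
proof
  let ?F = "Fraction_Field.Fract :: 'a \<Rightarrow> 'a \<Rightarrow> 'a fract"
  let ?L = "localization A"
  let ?Q = "ring_of_type_algebra :: 'a fract ring"
  interpret Q: ring ?Q by (rule ring_from_type_algebra)
  have nz: "s \<noteq> 0" if "s \<in> A" for s using that A by auto
  have ops: "carrier ?L = {?F a s |a s. s \<in> A}" "\<And>x y. x \<oplus>\<^bsub>?L\<^esub> y = x + y"
    "\<And>x y. x \<otimes>\<^bsub>?L\<^esub> y = x * y" "\<zero>\<^bsub>?L\<^esub> = 0"
    by (simp_all add: ring_of_type_algebra_def localization_def)
  have Qops: "carrier ?Q = UNIV" "\<And>x y. x \<oplus>\<^bsub>?Q\<^esub> y = x + y"
    "\<And>x y. x \<otimes>\<^bsub>?Q\<^esub> y = x * y" "\<zero>\<^bsub>?Q\<^esub> = 0" "\<one>\<^bsub>?Q\<^esub> = 1"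
    by (simp_all add: ring_of_type_algebra_def)
  have Qinv: "\<ominus>\<^bsub>?Q\<^esub> x = - x" for x by (rule Q.minus_equality) (auto simp: Qops)
  \<comment> \<open>The localization is the record of the fraction field with a smaller carrier, so
    its ring axioms follow from its being a subring.\<close>
  have "subring (carrier ?L) ?Q"
  proof (rule Q.subringI)
    show "\<one>\<^bsub>?Q\<^esub> \<in> carrier ?L" 
      unfolding ops Qops One_fract_def using A(1) by blast
    fix x y assume "x \<in> carrier ?L" "y \<in> carrier ?L"
    then obtain a s b u where x: "x = ?F a s" "s \<in> A" and y: "y = ?F b u" "u \<in> A"
      unfolding ops by blast
    show "\<ominus>\<^bsub>?Q\<^esub> x \<in> carrier ?L" 
      unfolding Qinv ops x minus_fract using x(2) by blast
    show "x \<otimes>\<^bsub>?Q\<^esub> y \<in> carrier ?L"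
      unfolding Qops ops x y mult_fract using A(3)[OF x(2) y(2)] by blast
    show "x \<oplus>\<^bsub>?Q\<^esub> y \<in> carrier ?L"
      unfolding Qops ops x y add_fract[OF nz[OF x(2)] nz[OF y(2)]] using A(3)[OF x(2) y(2)] by blast
  qed (simp add: Qops)
  then have "ring (?Q\<lparr>carrier := carrier ?L\<rparr>)" by (rule Q.subring_is_ring)
  then have L: "ring ?L" by (simp add: localization_def)
  then interpret L: ring ?L .
  let ?S = "(\<lambda>f. ?F f 1) ` J"
  { assume f: "?F f 1 \<in> Idl\<^bsub>?L\<^esub> ?S"
    let ?K = "{?F a s |a s. a \<in> J \<and> s \<in> A}"
    have "ideal ?K ?L"
    proof (rule idealI[OF L])
      show "subgroup ?K (add_monoid ?L)"
      proof (rule L.add.subgroupI)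
        show "?K \<subseteq> carrier ?L" unfolding ops by blast
        show "?K \<noteq> {}" using A(1) is_ideal_zero[OF J] by blast
        fix x y assume "x \<in> ?K" "y \<in> ?K"
        then obtain a s b u where x: "x = ?F a s" "a \<in> J" "s \<in> A" and y: "y = ?F b u" "b \<in> J" "u \<in> A"
          by blast
        have "x \<in> carrier ?L" "?F (- a) s \<in> carrier ?L" unfolding ops using x by blast+
        moreover have "?F (- a) s \<oplus>\<^bsub>?L\<^esub> x = \<zero>\<^bsub>?L\<^esub>"
          unfolding ops minus_fract[symmetric] x by (rule left_minus)
        ultimately have "\<ominus>\<^bsub>?L\<^esub> x = ?F (- a) s" by (intro L.minus_equality)
        then show "\<ominus>\<^bsub>?L\<^esub> x \<in> ?K" using x is_ideal_uminus[OF J x(2)] by blast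
        have "a * u + b * s \<in> J" using x y J by (intro is_ideal_add is_ideal_mult_right)
        then show "x \<oplus>\<^bsub>?L\<^esub> y \<in> ?K" using x y nz A(3)[of s u]
          by (intro CollectI exI[of _ "a * u + b * s"] exI[of _ "s * u"]) (simp add: ops)
      qed
      fix x y assume "x \<in> ?K" "y \<in> carrier ?L"
      then obtain a s b u where x: "x = ?F a s" "a \<in> J" "s \<in> A" and y: "y = ?F b u" "u \<in> A"
        unfolding ops by blast
      have "b * a \<in> J" "u * s \<in> A" using x y J A(3) by (auto intro: is_ideal_mult)
      then show "y \<otimes>\<^bsub>?L\<^esub> x \<in> ?K" "x \<otimes>\<^bsub>?L\<^esub> y \<in> ?K" using x y
        by (intro CollectI exI[of _ "b * a"] exI[of _ "u * s"], simp add: ops mult.commute)+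
    qed
    moreover have "?S \<subseteq> ?K" using A(1) by blast
    ultimately have "Idl\<^bsub>?L\<^esub> ?S \<subseteq> ?K" unfolding genideal_def by (intro Inter_lower CollectI conjI)
    then have "?F f 1 \<in> ?K" using f by (rule subsetD)
    then obtain a s where "?F f 1 = ?F a s" "a \<in> J" "s \<in> A" by blast
    then have "s * f = a" using nz[of s] by (simp add: eq_fract mult.commute)
    then show "\<exists>s\<in>A. s * f \<in> J" using \<open>a \<in> J\<close> \<open>s \<in> A\<close> by blast }
  assume "\<exists>s\<in>A. s * f \<in> J"
  then obtain s where s: "s \<in> A" "s * f \<in> J" ..
  have "?F f 1 \<in> K" if "ideal K ?L" "?S \<subseteq> K" for K
  proof -
    interpret K: ideal K ?L by fact
    have "?F (s * f) 1 \<in> K" using that(2) s(2) by blast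
    moreover have "?F 1 s \<in> carrier ?L" unfolding ops using s(1) by blast
    ultimately have "?F 1 s \<otimes>\<^bsub>?L\<^esub> ?F (s * f) 1 \<in> K" by (rule K.I_l_closed)
    moreover have "?F 1 s \<otimes>\<^bsub>?L\<^esub> ?F (s * f) 1 = ?F f 1"
      using nz[OF s(1)] by (simp add: ops eq_fract mult.commute)
    ultimately show ?thesis by simp
  qed
  then show "?F f 1 \<in> Idl\<^bsub>?L\<^esub> ?S" unfolding genideal_def by blast
qed

text \<open>The multiplicative set \<open>{1}\<close> suffices in
  \<open>exists_associated_prime\<close>. Without any associated prime, \<open>0\<close> would
  belong to the multiplicative system of the symbolic powers.\<close>

lemma associated_primes_nonempty:
  fixes I :: "('n::{finite,linorder}, 'k::field) mpoly set"
  assumes I: "is_ideal I" and "1 \<notin> I"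
  shows "associated_primes I \<noteq> {}"
proof -
  have "\<exists>h. is_prime {g. g * (h * 1) \<in> I} \<and> {1} \<inter> {g. g * (h * 1) \<in> I} = {}"
    by (rule exists_associated_prime[OF noetherian_mpoly I]) (use assms in auto)
  then obtain h where "is_prime {g. g * (h * 1) \<in> I} \<and> {1} \<inter> {g. g * (h * 1) \<in> I} = {}" ..
  then have "{g. g * (h * 1) \<in> I} \<in> associated_primes I"
    unfolding associated_primes_eq by (intro CollectI conjI exI[of _ "h * 1"] refl) (rule conjunct1)
  then show ?thesis by (metis empty_iff)
qed

lemma complement_associated_primes:
  assumes "associated_primes I \<noteq> {}"
  shows "1 \<in> - \<Union>(associated_primes I)" "0 \<notin> - \<Union>(associated_primes I)"
    "a \<in> - \<Union>(associated_primes I) \<Longrightarrow> b \<in> - \<Union>(associated_primes I) \<Longrightarrow> a * b \<in> - \<Union>(associated_primes I)"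
proof -
  have P: "is_prime P" if "P \<in> associated_primes I" for P
    using that by (auto simp: associated_primes_eq)
  show "1 \<in> - \<Union>(associated_primes I)" using P[THEN is_prime_one] by auto
  show "0 \<notin> - \<Union>(associated_primes I)" 
    using assms P[THEN is_prime_ideal, THEN is_ideal_zero] by auto
  show "a * b \<in> - \<Union>(associated_primes I)"
    if "a \<in> - \<Union>(associated_primes I)" "b \<in> - \<Union>(associated_primes I)"
  proof (rule ComplI)
    assume "a * b \<in> \<Union>(associated_primes I)"
    then obtain Q where Q: "Q \<in> associated_primes I" "a * b \<in> Q" by auto
    from is_prime_mult[OF P[OF Q(1)] Q(2)] show False using that Q(1) by auto
  qed
qed

lemma symbolic_power_iff:
  fixes I :: "('n::{finite,linorder}, 'k::field) mpoly set"
  assumes I: "is_ideal I" "1 \<notin> I"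
  shows "f \<in> symbolic_power I m \<longleftrightarrow> (\<exists>s\<in>- \<Union>(associated_primes I). s * f \<in> ideal_power I m)"
proof -
  note A = complement_associated_primes[OF associated_primes_nonempty[OF I]]
  show ?thesis
    unfolding symbolic_power_def Let_def vimage_eq
    by (rule localization_ideal_iff[OF A is_ideal_ideal_power[OF I(1)]])
qed

lemma ideal_power_subset_symbolic_power:
  fixes I :: "('n::{finite,linorder}, 'k::field) mpoly set"
  assumes I: "is_ideal I" "1 \<notin> I"
  shows "ideal_power I m \<subseteq> symbolic_power I m"
proof
  fix f assume "f \<in> ideal_power I m"
  then show "f \<in> symbolic_power I m"
    unfolding symbolic_power_iff[OF I]
    by (intro bexI[OF _ complement_associated_primes(1)[OF associated_primes_nonempty[OF I]]]) simp
qed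

lemma symbolic_power_mult:
  fixes I :: "('n::{finite,linorder}, 'k::field) mpoly set"
  assumes I: "is_ideal I" "1 \<notin> I" and f: "f \<in> symbolic_power I m" and g: "g \<in> symbolic_power I k"
  shows "f * g \<in> symbolic_power I (m + k)"
proof -
  note A = complement_associated_primes[OF associated_primes_nonempty[OF I]]
  obtain s where s: "s \<in> - \<Union>(associated_primes I)" "s * f \<in> ideal_power I m"
    using f unfolding symbolic_power_iff[OF I] ..
  obtain u where u: "u \<in> - \<Union>(associated_primes I)" "u * g \<in> ideal_power I k"
    using g unfolding symbolic_power_iff[OF I] ..
  have "(s * u) * (f * g) \<in> ideal_power I (m + k)"
    using ideal_power_mult[OF I(1) s(2) u(2)] by (simp add: ac_simps)
  then show ?thesis unfolding symbolic_power_iff[OF I] by (rule bexI[OF _ A(3)[OF s(1) u(1)]])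
qed

section \<open>Taylor expansion\<close>

lemma mult_singles:
  fixes f g :: "('a::comm_monoid_add, 'c::comm_semiring_0) poly_mapping"
  shows "f * g = (\<Sum>a\<in>Poly_Mapping.keys f. \<Sum>b\<in>Poly_Mapping.keys g.
    Poly_Mapping.single (a + b) (Poly_Mapping.lookup f a * Poly_Mapping.lookup g b))"
proof -
  have "f * g = (\<Sum>a\<in>Poly_Mapping.keys f. Poly_Mapping.single a (Poly_Mapping.lookup f a)) *
     (\<Sum>b\<in>Poly_Mapping.keys g. Poly_Mapping.single b (Poly_Mapping.lookup g b))"
    by (simp add: poly_mapping_sum_single)
  then show ?thesis by (simp add: sum_product mult_single)
qed

lemma additive_sum:
  assumes "h 0 = 0" "\<And>f g. h (f + g) = h f + h g"
  shows "h (sum f S) = (\<Sum>i\<in>S. h (f i))"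
  by (induction S rule: infinite_finite_induct) (auto simp: assms)

text \<open>Both sides are biadditive, so monomials are enough. This serves the Taylor expansion,
  the constant term, and the substitution \<open>x = 0\<close> in Taylor coefficients.\<close>

lemma multiplicative_if_singles:
  fixes h :: "('a::comm_monoid_add, 'c::comm_semiring_0) poly_mapping \<Rightarrow> 'd::comm_semiring_0"
  assumes h: "h 0 = 0" "\<And>f g. h (f + g) = h f + h g"
    and mult: "\<And>a b c d. h (Poly_Mapping.single (a + b) (c * d)) =
      h (Poly_Mapping.single a c) * h (Poly_Mapping.single b d)"
  shows "h (f * g) = h f * h g"
proof -
  note sum = additive_sum[of h, OF h]
  have "h f * h g = h (\<Sum>a\<in>Poly_Mapping.keys f. Poly_Mapping.single a (Poly_Mapping.lookup f a)) *
     h (\<Sum>b\<in>Poly_Mapping.keys g. Poly_Mapping.single b (Poly_Mapping.lookup g b))"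
    by (simp add: poly_mapping_sum_single)
  then show ?thesis
    unfolding mult_singles[of f g] sum mult sum_product by simp
qed

text \<open>\<open>taylor f\<close> is \<open>f (x + y)\<close>, as a polynomial in \<open>y\<close> with coefficients in \<open>k[x]\<close>.\<close>

definition taylor :: "('n::finite, 'k::field) mpoly \<Rightarrow> ('n, ('n, 'k) mpoly) mpoly" where
  "taylor f = (\<Sum>a\<in>Poly_Mapping.keys f. Poly_Mapping.single 0 (Poly_Mapping.single 0 (Poly_Mapping.lookup f a)) *
    (\<Prod>i\<in>UNIV. (Poly_Mapping.single 0 (var i) + Poly_Mapping.single (Poly_Mapping.single i 1) 1) ^ Poly_Mapping.lookup a i))"

lemma taylor_superset:
  assumes "finite S" "Poly_Mapping.keys f \<subseteq> S"
  shows "taylor f = (\<Sum>a\<in>S. Poly_Mapping.single 0 (Poly_Mapping.single 0 (Poly_Mapping.lookup f a)) *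
    (\<Prod>i\<in>UNIV. (Poly_Mapping.single 0 (var i) + Poly_Mapping.single (Poly_Mapping.single i 1) 1) ^ Poly_Mapping.lookup a i))"
  unfolding taylor_def using assms by (intro sum.mono_neutral_left) (auto simp: in_keys_iff)

lemma taylor_0: "taylor 0 = 0"
  by (simp add: taylor_def)

lemma taylor_add: "taylor (f + g) = taylor f + taylor g"
proof -
  let ?S = "Poly_Mapping.keys f \<union> Poly_Mapping.keys g"
  have "finite ?S" "Poly_Mapping.keys f \<subseteq> ?S" "Poly_Mapping.keys g \<subseteq> ?S" "Poly_Mapping.keys (f + g) \<subseteq> ?S"
    using keys_add[of f g] by auto
  then show ?thesis
    by (simp add: taylor_superset[of ?S] lookup_add single_add distrib_right sum.distrib)
qed

lemma taylor_single: "taylor (Poly_Mapping.single a c) = Poly_Mapping.single 0 (Poly_Mapping.single 0 c) *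
    (\<Prod>i\<in>UNIV. (Poly_Mapping.single 0 (var i) + Poly_Mapping.single (Poly_Mapping.single i 1) 1) ^ Poly_Mapping.lookup a i)"
  by (subst taylor_superset[of "{a}"]) auto

lemma taylor_mult: "taylor (f * g) = taylor f * taylor g"
proof (rule multiplicative_if_singles[OF taylor_0 taylor_add])
  fix a b :: "'a \<Rightarrow>\<^sub>0 nat" and c d :: 'b
  have "Poly_Mapping.single 0 (Poly_Mapping.single 0 (c * d)) =
    (Poly_Mapping.single 0 (Poly_Mapping.single 0 c) * Poly_Mapping.single 0 (Poly_Mapping.single 0 d)
      :: ('a, ('a, 'b) mpoly) mpoly)"
    by (simp add: mult_single)
  then show "taylor (Poly_Mapping.single (a + b) (c * d)) =
      taylor (Poly_Mapping.single a c) * taylor (Poly_Mapping.single b d)"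
    unfolding taylor_single lookup_add power_add prod.distrib by (simp only: ac_simps)
qed

lemma lookup_mult_in_ideal:
  fixes F G :: "('n::finite, 'r::comm_ring_1) mpoly"
  assumes P: "is_ideal P"
    and bc: "\<And>b c. b + c = a \<Longrightarrow> Poly_Mapping.lookup F b * Poly_Mapping.lookup G c \<in> P"
  shows "Poly_Mapping.lookup (F * G) a \<in> P"
  unfolding mult_singles[of F G] lookup_sum
  by (intro is_ideal_sum[OF P]) (auto simp: lookup_single when_def is_ideal_zero[OF P] bc)

lemma lookup_mult_0:
  fixes F G :: "('n::finite, 'r::comm_ring_1) mpoly"
  shows "Poly_Mapping.lookup (F * G) 0 = Poly_Mapping.lookup F 0 * Poly_Mapping.lookup G 0"
proof (rule multiplicative_if_singles[of "\<lambda>F. Poly_Mapping.lookup F 0"])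
  fix a b :: "'n \<Rightarrow>\<^sub>0 nat" and c d :: 'r
  have "a + b = 0 \<longleftrightarrow> a = 0 \<and> b = 0"
    by (auto simp: poly_mapping_eq_iff lookup_add fun_eq_iff)
  then show "Poly_Mapping.lookup (Poly_Mapping.single (a + b) (c * d)) 0 =
    Poly_Mapping.lookup (Poly_Mapping.single a c) 0 * Poly_Mapping.lookup (Poly_Mapping.single b d) 0"
    by (auto simp: lookup_single when_def)
qed (auto simp: lookup_add)

lemma multiplicative_prod:
  assumes "h 1 = 1" "\<And>f g. h (f * g) = h f * h g"
  shows "h (\<Prod>i\<in>S. f i ^ n i) = (\<Prod>i\<in>S. h (f i) ^ n i)"
proof -
  have "h (x ^ k) = h x ^ k" for x k by (induction k) (auto simp: assms)
  then show ?thesis by (induction S rule: infinite_finite_induct) (auto simp: assms)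
qed

text \<open>This is the substitution \<open>y = 0\<close> in \<open>f (x + y)\<close>: taking the
  constant term in \<open>y\<close> is multiplicative, so it can be computed on the factors of each
  monomial.\<close>

lemma lookup_taylor_0:
  fixes f :: "('n::finite, 'k::field) mpoly"
  shows "Poly_Mapping.lookup (taylor f) 0 = f"
proof -
  let ?h = "\<lambda>F :: ('n, ('n, 'k) mpoly) mpoly. Poly_Mapping.lookup F 0"
  have "Poly_Mapping.single i 1 \<noteq> (0 :: 'n \<Rightarrow>\<^sub>0 nat)" for i
    by (metis lookup_single_eq lookup_zero one_neq_zero)
  then have "?h (taylor (Poly_Mapping.single a c)) = Poly_Mapping.single a c" for a c
    unfolding taylor_single lookup_mult_0
    by (subst multiplicative_prod[of ?h])
      (auto simp: lookup_mult_0 lookup_add lookup_single single_eq_prod_var[of a c])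
  then have "?h (taylor (\<Sum>a\<in>Poly_Mapping.keys f. Poly_Mapping.single a (Poly_Mapping.lookup f a))) =
      (\<Sum>a\<in>Poly_Mapping.keys f. Poly_Mapping.single a (Poly_Mapping.lookup f a))"
    by (subst additive_sum[of "\<lambda>f. ?h (taylor f)"]) (auto simp: taylor_0 taylor_add lookup_add)
  then show ?thesis by (simp add: poly_mapping_sum_single)
qed

text \<open>Setting \<open>x = 0\<close> in \<open>f (x + y)\<close> gives back \<open>f\<close>.\<close>

lemma lookup_lookup_taylor:
  fixes f :: "('n::finite, 'k::field) mpoly"
  shows "Poly_Mapping.lookup (Poly_Mapping.lookup (taylor f) a) 0 = Poly_Mapping.lookup f a"
proof -
  define h where "h = (\<lambda>F :: ('n, ('n, 'k) mpoly) mpoly. Poly_Mapping.map (\<lambda>r. Poly_Mapping.lookup r 0) F)"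
  have lookup_h: "Poly_Mapping.lookup (h F) b = Poly_Mapping.lookup (Poly_Mapping.lookup F b) 0" for F b
    by (simp add: h_def map.rep_eq when_def)
  have h_single: "h (Poly_Mapping.single b r) = Poly_Mapping.single b (Poly_Mapping.lookup r 0)" for b r
    by (rule poly_mapping_eqI) (simp add: lookup_h lookup_single when_def)
  have h_0: "h 0 = 0" and h_add: "h (F + G) = h F + h G" for F G
    by (auto intro!: poly_mapping_eqI simp: lookup_h lookup_add)
  have h_mult: "h (F * G) = h F * h G" for F G
    by (rule multiplicative_if_singles) (simp_all add: h_0 h_add h_single lookup_mult_0 mult_single)
  have h_1: "h 1 = 1" using h_single[of 0 1] by simp
  have "Poly_Mapping.single i 1 \<noteq> (0 :: 'n \<Rightarrow>\<^sub>0 nat)" for i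
    by (metis lookup_single_eq lookup_zero one_neq_zero)
  then have "h (taylor (Poly_Mapping.single a c)) = Poly_Mapping.single a c" for a c
    unfolding taylor_single h_mult
    by (subst multiplicative_prod[of h, OF h_1 h_mult])
      (auto simp: h_add h_single var_def lookup_single single_eq_prod_var[of a c])
  then have "h (taylor (\<Sum>a\<in>Poly_Mapping.keys f. Poly_Mapping.single a (Poly_Mapping.lookup f a))) =
      (\<Sum>a\<in>Poly_Mapping.keys f. Poly_Mapping.single a (Poly_Mapping.lookup f a))"
    by (subst additive_sum[of "\<lambda>f. h (taylor f)"]) (auto simp: taylor_0 taylor_add h_0 h_add)
  then have "h (taylor f) = f" by (simp add: poly_mapping_sum_single)
  then show ?thesis by (metis lookup_h)
qed

text \<open>The coefficients of \<open>taylor f\<close> are the Hasse derivatives of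
  \<open>f\<close>. They work in every characteristic, whereas iterated partial derivatives carry
  factorials that may vanish.\<close>

definition vanishes_to_order :: "('n::finite, 'k::field) mpoly set \<Rightarrow> nat \<Rightarrow> ('n, 'k) mpoly \<Rightarrow> bool" where
  "vanishes_to_order P m f \<longleftrightarrow> (\<forall>a. mon_degree a < m \<longrightarrow> Poly_Mapping.lookup (taylor f) a \<in> P)"

lemma mon_degree_eq_0_iff: "mon_degree a = 0 \<longleftrightarrow> a = 0"
  by (auto simp: mon_degree_def poly_mapping_eq_iff fun_eq_iff)

text \<open>Leibniz rule: when an exponent of degree at most \<open>m\<close> is split as
  \<open>b + c\<close>, either \<open>b\<close> has degree below \<open>m\<close> and the first
  factor lies in \<open>P\<close> by induction, or \<open>c = 0\<close> and the second factor is
  \<open>v \<in> I\<close> itself.\<close>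

lemma vanishes_ideal_power:
  assumes P: "is_ideal P" and IP: "I \<subseteq> P" and f: "f \<in> ideal_power I m"
  shows "vanishes_to_order P m f"
  using f
proof (induction m arbitrary: f)
  case 0
  then show ?case by (simp add: vanishes_to_order_def)
next
  case (Suc m)
  from Suc.prems show ?case
  proof (induction rule: ideal_power_Suc_induct)
    case (mult u v)
    show ?case unfolding vanishes_to_order_def taylor_mult
    proof (intro allI impI lookup_mult_in_ideal P)
      fix a b c :: "'a \<Rightarrow>\<^sub>0 nat" assume a: "mon_degree a < Suc m" "b + c = a"
      show "Poly_Mapping.lookup (taylor u) b * Poly_Mapping.lookup (taylor v) c \<in> P"
      proof (cases "mon_degree b < m")
        case True
        then show ?thesis using Suc.IH[OF mult(1)] by (intro is_ideal_mult_right P) (simp add: vanishes_to_order_def)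
      next
        case False
        then have "c = 0" using a mon_degree_add[of b c] mon_degree_eq_0_iff[of c] by simp
        then show ?thesis using mult(2) IP by (intro is_ideal_mult P) (auto simp: lookup_taylor_0)
      qed
    qed
  next
    case (add x y)
    then show ?case using is_ideal_add[OF P] by (simp add: vanishes_to_order_def taylor_add lookup_add)
  qed
qed

text \<open>The coefficient of \<open>taylor (s * f)\<close> at \<open>a\<close> is \<open>s\<close>
  times that of \<open>taylor f\<close>, up to terms containing coefficients of
  \<open>taylor f\<close> of lower degree. By induction these lie in \<open>P\<close>, and primeness
  removes \<open>s\<close>. This carries vanishing from \<open>I^m\<close> over to
  \<open>I^(m)\<close>.\<close>

lemma vanishes_cancel:
  assumes P: "is_prime P" and s: "s \<notin> P" and sf: "vanishes_to_order P m (s * f)"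
  shows "vanishes_to_order P m f"
  unfolding vanishes_to_order_def
proof (intro allI impI)
  note P' = is_prime_ideal[OF P]
  fix a :: "'a \<Rightarrow>\<^sub>0 nat" assume "mon_degree a < m"
  then show "Poly_Mapping.lookup (taylor f) a \<in> P"
  proof (induction "mon_degree a" arbitrary: a rule: less_induct)
    case less
    let ?S = "taylor s - Poly_Mapping.single 0 s"
    have "Poly_Mapping.lookup (?S * taylor f) a \<in> P"
    proof (rule lookup_mult_in_ideal[OF P'])
      fix b c assume bc: "b + c = a"
      show "Poly_Mapping.lookup ?S b * Poly_Mapping.lookup (taylor f) c \<in> P"
      proof (cases "b = 0")
        case True
        then show ?thesis by (simp add: lookup_minus lookup_taylor_0 is_ideal_zero[OF P'])
      next
        case False
        then have "mon_degree c < mon_degree a"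
          using bc mon_degree_add[of b c] mon_degree_eq_0_iff[of b] by simp
        then show ?thesis using less by (intro is_ideal_mult P') auto
      qed
    qed
    moreover have "Poly_Mapping.lookup (Poly_Mapping.single 0 s * taylor f) a = s * Poly_Mapping.lookup (taylor f) a"
      by (simp add: map.rep_eq when_def flip: mult_map_scale_conv_mult)
    ultimately have "Poly_Mapping.lookup (taylor (s * f)) a - s * Poly_Mapping.lookup (taylor f) a \<in> P"
      by (simp add: taylor_mult left_diff_distrib lookup_minus)
    moreover have "Poly_Mapping.lookup (taylor (s * f)) a \<in> P"
      using sf less.prems by (simp add: vanishes_to_order_def)
    ultimately have "s * Poly_Mapping.lookup (taylor f) a \<in> P"
      using is_ideal_diff[OF P', of "Poly_Mapping.lookup (taylor (s * f)) a"] by fastforce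
    then show ?case using is_prime_mult[OF P] s by blast
  qed
qed

lemma hcomp_0_eq: "hcomp 0 f = Poly_Mapping.single 0 (Poly_Mapping.lookup f 0)"
  by (rule poly_mapping_eqI) (auto simp: lookup_hcomp lookup_single when_def mon_degree_eq_0_iff)

text \<open>A nonzero constant term would itself be a component in \<open>P\<close>, and it is a
  unit.\<close>

lemma graded_subset_irrelevant:
  assumes P: "is_ideal P" "graded P" "1 \<notin> P"
  shows "P \<subseteq> irrelevant_ideal"
proof
  fix f assume "f \<in> P"
  then have c: "Poly_Mapping.single 0 (Poly_Mapping.lookup f 0) \<in> P"
    using gradedD[OF P(2), of f 0] by (simp add: hcomp_0_eq)
  have "Poly_Mapping.lookup f 0 = 0"
  proof (rule ccontr)
    assume "Poly_Mapping.lookup f 0 \<noteq> 0"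
    then have "Poly_Mapping.single 0 (inverse (Poly_Mapping.lookup f 0)) * Poly_Mapping.single 0 (Poly_Mapping.lookup f 0) = 1"
      by (simp add: mult_single)
    then show False using is_ideal_mult[OF P(1) c] P(3) by metis
  qed
  then show "f \<in> irrelevant_ideal" by (simp add: irrelevant_ideal_def)
qed

text \<open>If \<open>t < m\<close>, the Taylor coefficient of \<open>f\<close> at one of its own
  monomials \<open>a\<close> lies in an associated prime, hence has no constant term. But its
  constant term is the nonzero coefficient of \<open>f\<close> at \<open>a\<close>.\<close>

theorem symbolic_power_form_degree:
  fixes I :: "('n::{finite,linorder}, 'k::field) mpoly set"
  assumes I: "is_ideal I" "1 \<notin> I" "graded I"
    and f: "f \<in> symbolic_power I m" "form t f" "f \<noteq> 0"
  shows "m \<le> t"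
proof (rule ccontr)
  assume "\<not> m \<le> t"
  obtain s where s: "s \<in> - \<Union>(associated_primes I)" "s * f \<in> ideal_power I m"
    using f(1) unfolding symbolic_power_iff[OF I(1,2)] ..
  obtain P where "P \<in> associated_primes I" using associated_primes_nonempty[OF I(1,2)] by auto
  then obtain g where P: "is_prime P" "P = {h. h * g \<in> I}" and sP: "s \<notin> P"
    using s by (auto simp: associated_primes_eq)
  note P' = is_prime_ideal[OF P(1)]
  have "I \<subseteq> P" using is_ideal_mult_right[OF I(1)] by (auto simp: P(2))
  then have v: "vanishes_to_order P m f"
    using vanishes_cancel[OF P(1) sP] vanishes_ideal_power[OF P' _ s(2)] by blast
  obtain a where a: "a \<in> Poly_Mapping.keys f" using f(3) by fastforce
  then have "mon_degree a = t" using f(2) by (simp add: form_def)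
  then have "Poly_Mapping.lookup (taylor f) a \<in> P"
    using v \<open>\<not> m \<le> t\<close> by (simp add: vanishes_to_order_def)
  then have "Poly_Mapping.lookup (taylor f) a \<in> irrelevant_ideal"
    using graded_subset_irrelevant[OF P' graded_associated_prime[OF I(1,3) P] is_prime_one[OF P(1)]] by blast
  then show False using a by (simp add: irrelevant_ideal_def lookup_lookup_taylor in_keys_iff)
qed

section \<open>Degrees of saturated forms\<close>

text \<open>For an ideal \<open>J\<close> this consists of the \<open>f\<close> that some power of
  the irrelevant ideal multiplies into \<open>J\<close>. It is phrased with forms to suit degree
  counts; \<open>q\<close> may depend on \<open>f\<close>.\<close>

definition saturation :: "('n::finite, 'k::field) mpoly set \<Rightarrow> ('n, 'k) mpoly set" where
  "saturation J = {f. \<exists>q. \<forall>c t. form t c \<longrightarrow> q \<le> t \<longrightarrow> c * f \<in> J}"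

lemma saturation_mono: "J \<subseteq> K \<Longrightarrow> saturation J \<subseteq> saturation K"
  unfolding saturation_def by (intro Collect_mono) (meson subsetD)

lemma graded_saturation:
  assumes "graded J"
  shows "graded (saturation J)"
  unfolding graded_def
proof (intro ballI allI)
  fix f s assume "f \<in> saturation J"
  then obtain q where q: "\<forall>c t. form t c \<longrightarrow> q \<le> t \<longrightarrow> c * f \<in> J" by (auto simp: saturation_def)
  have "c * hcomp s f \<in> J" if c: "form t c" "q \<le> t" for c t
  proof -
    have "f * c \<in> J" using q c by (simp add: mult.commute[of f c])
    then have "hcomp (s + t) (f * c) \<in> J" by (rule gradedD[OF assms])
    then show ?thesis by (simp add: hcomp_mult_form[OF c(1)] mult.commute[of c])
  qed
  then show "hcomp s f \<in> saturation J" by (auto simp: saturation_def)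
qed

text \<open>The \<open>LEAST\<close> in \<open>omega\<close> is attained only once some degree bound
  for generators exists. Finitely many homogeneous generators supply one, the sum of their
  degrees.\<close>

lemma omega_generates:
  fixes I :: "('n::finite, 'k::field) mpoly set"
  assumes I: "is_ideal I" "graded I"
  shows "I = lspan UNIV {f \<in> I. \<exists>d\<le>omega I. form d f}"
proof -
  let ?G = "\<lambda>t. {f \<in> I. \<exists>d\<le>t. form d f}"
  let ?H = "{f \<in> I. \<exists>t. form t f}"
  have IH: "I = lspan UNIV ?H"
    using I homogeneous_ideal_iff[of I] by (auto simp: homogeneous_ideal_def genideal_ring_of_type_algebra)
  obtain F where F: "F \<subseteq> ?H" "finite F" "?H \<subseteq> lspan UNIV F"
    using noetherian_mpoly[unfolded noetherian_def, rule_format, OF subset_UNIV, of ?H] by (elim exE conjE)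
  have "\<forall>f\<in>F. \<exists>t. form t f" using F(1) by auto
  then obtain d where d: "\<And>f. f \<in> F \<Longrightarrow> form (d f) f" by metis
  define t where "t = (\<Sum>f\<in>F. d f)"
  have "d f \<le> t" if "f \<in> F" for f unfolding t_def using F(2) that by (intro member_le_sum) auto
  then have "f \<in> ?G t" if "f \<in> F" for f using that F(1) d[OF that] by blast
  then have "lspan UNIV F \<subseteq> lspan UNIV (?G t)" by (intro lspan_mono subsetI)
  with F(3) have "?H \<subseteq> lspan UNIV (?G t)" by (rule order_trans)
  then have "lspan UNIV ?H \<subseteq> lspan UNIV (?G t)" by (rule lspan_trans[OF ring_closed_UNIV])
  then have "I \<subseteq> lspan UNIV (?G t)" by (simp flip: IH)
  moreover have "lspan UNIV (?G t) \<subseteq> I" by (rule lspan_ideal[OF I(1)]) auto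
  ultimately have "I = lspan UNIV (?G t)" by (rule equalityI)
  then show ?thesis
    unfolding omega_def genideal_ring_of_type_algebra by (rule LeastI)
qed

lemma lspan_mult_lspan:
  assumes u: "u \<in> lspan UNIV A" and v: "v \<in> lspan UNIV B"
    and AB: "\<And>a b. a \<in> A \<Longrightarrow> b \<in> B \<Longrightarrow> a * b \<in> C"
  shows "u * v \<in> lspan UNIV C"
proof -
  note C = is_ideal_lspan[of C]
  have ub: "u * b \<in> lspan UNIV C" if b: "b \<in> B" for b
  proof -
    have "u \<in> {u. u * b \<in> lspan UNIV C}"
    proof (rule lspan_closed[OF u])
      fix r a assume "a \<in> A"
      then have "r * (a * b) \<in> lspan UNIV C"
        using AB b by (intro is_ideal_mult[OF C] lspan_base[OF ring_closed_UNIV])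
      then show "r * a \<in> {u. u * b \<in> lspan UNIV C}" by (simp add: mult.assoc)
    qed (use C in \<open>auto simp: distrib_right is_ideal_zero is_ideal_add\<close>)
    then show ?thesis by simp
  qed
  have "v \<in> {v. u * v \<in> lspan UNIV C}"
  proof (rule lspan_closed[OF v])
    fix r b assume "b \<in> B"
    then have "r * (u * b) \<in> lspan UNIV C" by (intro is_ideal_mult[OF C] ub)
    then show "r * b \<in> {v. u * v \<in> lspan UNIV C}" by (simp add: ac_simps)
  qed (use C in \<open>auto simp: distrib_left is_ideal_zero is_ideal_add\<close>)
  then show ?thesis by simp
qed

lemma ideal_power_generated:
  fixes I :: "('n::finite, 'k::field) mpoly set"
  assumes I: "is_ideal I" "graded I"
  shows "ideal_power I k \<subseteq> lspan UNIV {u \<in> ideal_power I k. \<exists>d\<le>omega I * k. form d u}"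
proof (induction k)
  case 0
  have "1 \<in> lspan UNIV {u \<in> ideal_power I 0. \<exists>d\<le>omega I * 0. form d u}"
    by (rule lspan_base[OF ring_closed_UNIV]) (auto simp: ideal_power_0 form_1)
  then show ?case using is_ideal_one[OF is_ideal_lspan] by blast
next
  case (Suc k)
  let ?G = "\<lambda>k. {u \<in> ideal_power I k. \<exists>d\<le>omega I * k. form d u}"
  show ?case
  proof
    fix x assume "x \<in> ideal_power I (Suc k)"
    then show "x \<in> lspan UNIV (?G (Suc k))"
    proof (induction rule: ideal_power_Suc_induct)
      case (mult u v)
      have u: "u \<in> lspan UNIV (?G k)" using Suc mult(1) by (rule subsetD)
      have v: "v \<in> lspan UNIV {f \<in> I. \<exists>d\<le>omega I. form d f}"
        using mult(2) omega_generates[OF I] by simp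
      show ?case
      proof (rule lspan_mult_lspan[OF u v])
        fix a b assume "a \<in> ?G k" and b: "b \<in> {f \<in> I. \<exists>d\<le>omega I. form d f}"
        then obtain d where d: "a \<in> ideal_power I k" "d \<le> omega I * k" "form d a" by auto
        obtain d' where d': "b \<in> I" "d' \<le> omega I" "form d' b" using b by auto
        have "form (d + d') (a * b)" by (rule form_mult[OF d(3) d'(3)])
        moreover have "d + d' \<le> omega I * Suc k" using d(2) d'(2) by simp
        ultimately show "a * b \<in> ?G (Suc k)" using ideal_power_Suc_mult[OF d(1) d'(1)] by blast
      qed
    next
      case (add x y)
      then show ?case by (rule lspan_add)
    qed
  qed
qed

section \<open>The Rees algebra and a degree bound uniform in the power\<close>

definition rees :: "('n::finite, 'k::field) mpoly set \<Rightarrow> ('n, 'k) mpoly poly set" where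
  "rees I = {p. \<forall>r. coeff p r \<in> ideal_power I r}"

lemma ring_closed_rees:
  assumes I: "is_ideal I"
  shows "ring_closed (rees I)"
  unfolding ring_closed_def
proof (intro conjI ballI)
  note Ir = is_ideal_ideal_power[OF I]
  show "0 \<in> rees I" by (simp add: rees_def is_ideal_zero[OF Ir])
  show "1 \<in> rees I" by (auto simp: rees_def is_ideal_zero[OF Ir] ideal_power_0)
  fix p q assume pq: "p \<in> rees I" "q \<in> rees I"
  show "p + q \<in> rees I" "p - q \<in> rees I"
    using pq by (auto simp: rees_def is_ideal_add[OF Ir] is_ideal_diff[OF Ir])
  show "p * q \<in> rees I" unfolding rees_def mem_Collect_eq coeff_mult
  proof (intro allI is_ideal_sum[OF Ir])
    fix r i :: nat assume i: "i \<in> {..r}"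
    have "coeff p i * coeff q (r - i) \<in> ideal_power I (i + (r - i))"
      using pq by (intro ideal_power_mult[OF I]) (auto simp: rees_def)
    then show "coeff p i * coeff q (r - i) \<in> ideal_power I r" using i by simp
  qed
qed

text \<open>\<open>C\<close> is generated over the constants by \<open>f z\<close> for finitely many
  generators \<open>f\<close> of \<open>I\<close>. It is the whole Rees algebra, presented by the
  two facts used later: its elements have coefficients in the right powers, and it contains every
  \<open>g z^r\<close> with \<open>g \<in> I^r\<close>.\<close>

lemma noetherian_rees:
  fixes I :: "('n::finite, 'k::field) mpoly set"
  assumes I: "is_ideal I"
  obtains C where "ring_closed C" "noetherian C" "C \<subseteq> rees I"
    "\<And>r g. g \<in> ideal_power I r \<Longrightarrow> monom g r \<in> C"
proof -
  note Ir = is_ideal_ideal_power[OF I]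
  let ?c = "\<lambda>c :: ('n, 'k) mpoly. [:c:]"
  obtain F where F: "F \<subseteq> I" "finite F" "I \<subseteq> lspan UNIV F"
    using noetherian_mpoly[unfolded noetherian_def, rule_format, OF subset_UNIV, of I] by blast
  have n: "noetherian (range ?c)"
    by (rule noetherian_image[OF ring_closed_UNIV noetherian_mpoly]) auto
  have rc: "ring_closed (range ?c)"
    unfolding ring_closed_def using image_eqI[of 0 ?c 0 UNIV] image_eqI[of 1 ?c 1 UNIV] by auto
  have fin: "finite ((\<lambda>f. monom f 1) ` F)" using F by simp
  from noetherian_adjoin[OF rc n fin]
  obtain C where C: "ring_closed C" "noetherian C" "range ?c \<union> (\<lambda>f. monom f 1) ` F \<subseteq> C"
    and C_least: "\<And>D. ring_closed D \<Longrightarrow> range ?c \<union> (\<lambda>f. monom f 1) ` F \<subseteq> D \<Longrightarrow> C \<subseteq> D"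
    by meson
  have times: "x * y \<in> C" if "x \<in> C" "y \<in> C" for x y using C(1) that by (simp add: ring_closed_def)
  have plus: "x + y \<in> C" if "x \<in> C" "y \<in> C" for x y using C(1) that by (simp add: ring_closed_def)
  have const: "[:c:] \<in> C" for c using C(3) by blast
  have "C \<subseteq> rees I"
  proof (rule C_least[OF ring_closed_rees[OF I]])
    have "f \<in> ideal_power I (Suc 0)" if "f \<in> F" for f using that F ideal_power_one[OF I] by auto
    then show "range ?c \<union> (\<lambda>f. monom f 1) ` F \<subseteq> rees I"
      by (auto simp: rees_def coeff_pCons ideal_power_0 is_ideal_zero[OF Ir] split: nat.split)
  qed
  moreover have "monom g r \<in> C" if "g \<in> ideal_power I r" for g r
    using that
  proof (induction r arbitrary: g)
    case 0
    then show ?case using const by (simp add: monom_0)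
  next
    case (Suc r)
    from Suc.prems show ?case
    proof (induction rule: ideal_power_Suc_induct)
      case (mult u v)
      have "v \<in> lspan UNIV F" using mult(2) F(3) by (rule rev_subsetD)
      then have "v \<in> {v. monom (u * v) (Suc r) \<in> C}"
      proof (rule lspan_closed)
        fix a x assume "x \<in> F"
        then have "monom x 1 \<in> C" using C(3) by blast
        then have "[:a:] * (monom u r * monom x 1) \<in> C" using Suc.IH[OF mult(1)] const times by blast
        moreover have "[:a:] * (monom u r * monom x 1) = monom (u * (a * x)) (Suc r)"
          by (simp add: mult_monom smult_monom ac_simps)
        ultimately show "a * x \<in> {v. monom (u * v) (Suc r) \<in> C}" by simp
      qed (use plus const[of 0] in \<open>auto simp: distrib_left simp flip: add_monom\<close>)
      then show ?case by simp
    next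
      case (add x y)
      then show ?case using plus by (simp flip: add_monom)
    qed
  qed
  ultimately show ?thesis by (rule that[OF C(1,2)])
qed

text \<open>A component of degree \<open>s\<close> of an element of \<open>I^k\<close> is a
  combination of forms \<open>u \<in> I^k\<close> of degree \<open>d \<le> omega I * k\<close>, with
  coefficients of degree \<open>s - d \<ge> q\<close>. These coefficients push \<open>g\<close> into
  \<open>I^b\<close>, and \<open>u\<close> contributes \<open>k\<close> further factors from
  \<open>I\<close>.\<close>

lemma form_mult_saturated:
  fixes I :: "('n::finite, 'k::field) mpoly set"
  assumes I: "is_ideal I" "graded I"
    and h: "h \<in> ideal_power I k" "omega I * k + q \<le> s"
    and g: "\<And>c t. form t c \<Longrightarrow> q \<le> t \<Longrightarrow> c * g \<in> ideal_power I b"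
  shows "hcomp s h * g \<in> ideal_power I (k + b)"
proof -
  note J = is_ideal_ideal_power[OF I(1), of "k + b"]
  have "h \<in> lspan UNIV {u \<in> ideal_power I k. \<exists>d\<le>omega I * k. form d u}"
    using ideal_power_generated[OF I] h(1) by (rule subsetD)
  then have "h \<in> {h. hcomp s h * g \<in> ideal_power I (k + b)}"
  proof (rule lspan_closed)
    fix a u assume "u \<in> {u \<in> ideal_power I k. \<exists>d\<le>omega I * k. form d u}"
    then obtain d where u: "u \<in> ideal_power I k" "d \<le> omega I * k" "form d u" by auto
    have "hcomp (s - d) a * g \<in> ideal_power I b"
      using h(2) u(2) by (intro g[OF form_hcomp]) simp
    then have "u * (hcomp (s - d) a * g) \<in> ideal_power I (k + b)"
      by (rule ideal_power_mult[OF I(1) u(1)])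
    moreover have "d \<le> s" using h(2) u(2) by simp
    ultimately show "a * u \<in> {h. hcomp s h * g \<in> ideal_power I (k + b)}"
      by (simp add: hcomp_mult_form[OF u(3)] ac_simps)
  qed (auto simp: is_ideal_zero[OF J] is_ideal_add[OF J] hcomp_add distrib_right)
  then show ?thesis by simp
qed

text \<open>The elements \<open>g z\<^sup>r\<close> with \<open>g \<in> I\<^sup>r\<close> and \<open>g\<close> in the saturation of \<open>I\<^sup>r\<^sup>+\<^sup>1\<close> span an ideal of the
  Noetherian Rees algebra; the degrees of finitely many generators give the bound.\<close>

lemma saturation_step_bound:
  fixes I :: "('n::finite, 'k::field) mpoly set"
  assumes I: "is_ideal I" "graded I"
  shows "\<exists>e. \<forall>r f t. form t f \<longrightarrow> f \<in> ideal_power I r \<longrightarrow> f \<in> saturation (ideal_power I (Suc r)) \<longrightarrow>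
    omega I * r + e \<le> t \<longrightarrow> f \<in> ideal_power I (Suc r)"
proof -
  note Ir = is_ideal_ideal_power[OF I(1)]
  obtain C where C: "ring_closed C" "noetherian C" "C \<subseteq> rees I"
    "\<And>r g. g \<in> ideal_power I r \<Longrightarrow> monom g r \<in> C"
    by (rule noetherian_rees[OF I(1)]) blast
  define Z where "Z = {monom g r |g r. (\<exists>d. form d g) \<and> g \<in> ideal_power I r \<and> g \<in> saturation (ideal_power I (Suc r))}"
  have "Z \<subseteq> C" unfolding Z_def using C(4) by blast
  then obtain F where F: "F \<subseteq> Z" "finite F" "Z \<subseteq> lspan C F"
    using C(2)[unfolded noetherian_def, rule_format, of Z] by blast
  have "\<exists>g r d q. x = monom g r \<and> form d g \<and>
      (\<forall>c t. form t c \<longrightarrow> q \<le> t \<longrightarrow> c * g \<in> ideal_power I (Suc r))" if "x \<in> F" for x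
  proof -
    have "x \<in> Z" using that F(1) by (rule rev_subsetD)
    then show ?thesis unfolding Z_def saturation_def by blast
  qed
  then obtain g b d q where x: "\<And>x. x \<in> F \<Longrightarrow> x = monom (g x) (b x)" "\<And>x. x \<in> F \<Longrightarrow> form (d x) (g x)"
    "\<And>x c t. x \<in> F \<Longrightarrow> form t c \<Longrightarrow> q x \<le> t \<Longrightarrow> c * g x \<in> ideal_power I (Suc (b x))"
    by metis
  \<comment> \<open>For a generator \<open>x\<close>, \<open>d x\<close> is its degree and
    \<open>q x\<close> an exponent from which forms multiply it into the next power. The sum over
    \<open>F\<close> bounds every \<open>d x + q x\<close>.\<close>
  define e where "e = (\<Sum>x\<in>F. d x + q x)"
  have e: "d x + q x \<le> e" if "x \<in> F" for x
    unfolding e_def using F(2) that by (intro member_le_sum[of x F "\<lambda>x. d x + q x"]) auto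
  have "f \<in> ideal_power I (Suc r)"
    if f: "form t f" "f \<in> ideal_power I r" "f \<in> saturation (ideal_power I (Suc r))" "omega I * r + e \<le> t"
    for r f t
  proof -
    have "monom f r \<in> Z" unfolding Z_def using f by blast
    then have "monom f r \<in> lspan C F" using F(3) by (rule rev_subsetD)
    then obtain c where c: "\<forall>x\<in>F. c x \<in> C" "monom f r = (\<Sum>x\<in>F. c x * x)"
      using lspan_sum[OF F(2) _ C(1)] by blast
    have "hcomp t (coeff (c y * y) r) \<in> ideal_power I (Suc r)" if y: "y \<in> F" for y
    proof -
      have "coeff (c y * y) r = (if b y \<le> r then coeff (c y) (r - b y) * g y else 0)"
        using coeff_monom_mult[of "g y" "b y" "c y" r] x(1)[OF y] by (simp add: mult.commute)
      moreover have "hcomp t (coeff (c y) (r - b y) * g y) \<in> ideal_power I (Suc r)" if b: "b y \<le> r"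
      proof -
        have cy: "coeff (c y) (r - b y) \<in> ideal_power I (r - b y)"
          using c(1) C(3) y by (auto simp: rees_def)
        \<comment> \<open>The cofactor of \<open>g y\<close> has degree \<open>t - d y\<close>,
          still at least \<open>omega I * (r - b y) + q y\<close>. The product thus lies in the
          power \<open>(r - b y) + (b y + 1) = r + 1\<close>: this is the gain of one.\<close>
        have "omega I * (r - b y) \<le> omega I * r" by simp
        then have "omega I * (r - b y) + q y \<le> t - d y" "d y \<le> t" using f(4) e[OF y] by linarith+
        then have "hcomp (t - d y) (coeff (c y) (r - b y)) * g y \<in> ideal_power I (r - b y + Suc (b y))"
          by (intro form_mult_saturated[OF I cy, of "q y"] x(3)[OF y])
        then show ?thesis
          using b \<open>d y \<le> t\<close> by (simp add: hcomp_mult_form[OF x(2)[OF y]])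
      qed
      ultimately show ?thesis by (simp add: is_ideal_zero[OF Ir])
    qed
    then have "(\<Sum>y\<in>F. hcomp t (coeff (c y * y) r)) \<in> ideal_power I (Suc r)"
      by (rule is_ideal_sum[OF Ir])
    moreover have "hcomp t (coeff (monom f r) r) = f" using f(1) by (simp add: hcomp_form)
    ultimately show ?thesis unfolding c(2) by (simp add: coeff_sum hcomp_sum)
  qed
  then show ?thesis by blast
qed

text \<open>Start from \<open>I^0\<close>, which is the whole ring, and raise the exponent by one at
  a time. The requirement \<open>omega I * j + e \<le> t\<close> is hardest for the largest
  \<open>j\<close>, so the constant of a single step serves for all of them.\<close>

theorem saturation_bound:
  fixes I :: "('n::finite, 'k::field) mpoly set"
  assumes I: "is_ideal I" "graded I"
  shows "\<exists>e. \<forall>r f t. form t f \<longrightarrow> f \<in> saturation (ideal_power I r) \<longrightarrow> omega I * r + e \<le> t \<longrightarrow> f \<in> ideal_power I r"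
proof -
  from saturation_step_bound[OF I] obtain e where
    e': "\<forall>r f t. form t f \<longrightarrow> f \<in> ideal_power I r \<longrightarrow> f \<in> saturation (ideal_power I (Suc r)) \<longrightarrow>
      omega I * r + e \<le> t \<longrightarrow> f \<in> ideal_power I (Suc r)" ..
  note e = e'[rule_format]
  have "f \<in> ideal_power I r"
    if f: "form t f" "f \<in> saturation (ideal_power I r)" "omega I * r + e \<le> t" for r f t
  proof -
    have "f \<in> ideal_power I j" if "j \<le> r" for j
      using that
    proof (induction j)
      case 0
      show ?case by (simp add: ideal_power_0)
    next
      case (Suc j)
      have "saturation (ideal_power I r) \<subseteq> saturation (ideal_power I (Suc j))"
        by (rule saturation_mono[OF ideal_power_antimono[OF I(1) Suc.prems]])
      then have "f \<in> saturation (ideal_power I (Suc j))" using f(2) by (rule subsetD)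
      moreover have "omega I * j + e \<le> t"
        using f(3) mult_le_mono2[of j r "omega I"] Suc.prems by linarith
      ultimately show ?case using Suc.IH Suc.prems f(1) by (intro e[of t f j]) simp_all
    qed
    then show ?thesis by simp
  qed
  then show ?thesis by (intro exI[of _ e] allI impI)
qed

section \<open>Points of a zero-dimensional subscheme\<close>

lemma proj_points_iff:
  "P \<in> proj_points \<longleftrightarrow> is_prime P \<and> graded P \<and> \<not> irrelevant_ideal \<subseteq> P"
  by (auto simp: proj_points_def primeideal_ring_of_type_algebra_iff homogeneous_ideal_iff is_prime_ideal)

lemma topspace_zariski: "topspace zariski_topology = (proj_points :: ('n::finite, 'k::field) mpoly set set)"
proof
  show "topspace zariski_topology \<subseteq> (proj_points :: ('n, 'k) mpoly set set)"
    unfolding zariski_topology_def topology_generated_by_topspace by auto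
  show "(proj_points :: ('n, 'k) mpoly set set) \<subseteq> topspace zariski_topology"
  proof
    fix P :: "('n, 'k) mpoly set" assume P: "P \<in> proj_points"
    then have "P \<in> {P \<in> proj_points. 1 \<notin> P}" by (simp add: proj_points_iff is_prime_one)
    moreover have "{P \<in> proj_points. 1 \<notin> P} \<in> {{P \<in> proj_points. f \<notin> P} | f :: ('n, 'k) mpoly. \<exists>t. form t f}"
      by (intro CollectI exI[of _ 1] conjI refl exI[of _ 0] form_1)
    ultimately show "P \<in> topspace zariski_topology"
      unfolding zariski_topology_def topology_generated_by_topspace by (rule UnionI[rotated])
  qed
qed

lemma topspace_subscheme_space: "topspace (subscheme_space I) = {P \<in> proj_points. I \<subseteq> P}"
  unfolding subscheme_space_def topspace_subtopology topspace_zariski by blast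

lemma exists_form_notin:
  assumes "graded Q" "is_ideal P" "\<not> Q \<subseteq> P"
  shows "\<exists>t f. form t f \<and> f \<in> Q \<and> f \<notin> P"
proof (rule ccontr)
  assume no: "\<not> ?thesis"
  obtain f where f: "f \<in> Q" "f \<notin> P" using assms(3) by auto
  obtain S where S: "(\<Sum>t\<in>S. hcomp t f) = f" by (rule obtain_sum_hcomp[of f])
  have "hcomp t f \<in> P" for t using no gradedD[OF assms(1) f(1), of t] form_hcomp[of t f] by auto
  then have "(\<Sum>t\<in>S. hcomp t f) \<in> P" by (rule is_ideal_sum[OF assms(2)])
  then show False using S f(2) by simp
qed

lemma closedin_zariski:
  fixes P :: "('n::finite, 'k::field) mpoly set"
  assumes "graded P"
  shows "closedin zariski_topology {R \<in> proj_points. P \<subseteq> R}"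
  unfolding closedin_def
proof
  show "{R \<in> proj_points. P \<subseteq> R} \<subseteq> topspace zariski_topology" by (simp add: topspace_zariski)
  let ?B = "{{R \<in> proj_points. f \<notin> R} | f. f \<in> P \<and> (\<exists>t. form t f)}"
  have "topspace zariski_topology - {R \<in> proj_points. P \<subseteq> R} = \<Union>?B"
  proof
    show "topspace zariski_topology - {R \<in> proj_points. P \<subseteq> R} \<subseteq> \<Union>?B"
    proof
      fix R assume "R \<in> topspace zariski_topology - {R \<in> proj_points. P \<subseteq> R}"
      then have R: "R \<in> proj_points" "\<not> P \<subseteq> R" by (auto simp: topspace_zariski)
      then have "is_ideal R" by (simp add: proj_points_iff is_prime_ideal)
      from exists_form_notin[OF assms this R(2)]
      obtain t f where f: "form t f" "f \<in> P" "f \<notin> R" by (elim exE conjE)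
      then have "{R \<in> proj_points. f \<notin> R} \<in> ?B" by (intro CollectI exI[of _ f] conjI refl exI[of _ t])
      moreover have "R \<in> {R \<in> proj_points. f \<notin> R}" using R(1) f(3) by simp
      ultimately show "R \<in> \<Union>?B" by (rule UnionI)
    qed
    show "\<Union>?B \<subseteq> topspace zariski_topology - {R \<in> proj_points. P \<subseteq> R}"
      unfolding topspace_zariski by auto
  qed
  moreover have "openin zariski_topology (\<Union>?B)"
  proof (rule openin_Union)
    fix W assume "W \<in> ?B"
    then have "W \<in> {{P \<in> proj_points. f \<notin> P} | f. \<exists>t. form t f}" by auto
    then show "openin zariski_topology W"
      unfolding zariski_topology_def by (rule topology_generated_by_Basis)
  qed
  ultimately show "openin zariski_topology (topspace zariski_topology - {R \<in> proj_points. P \<subseteq> R})"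
    by simp
qed

text \<open>Basic open sets pass to smaller primes, and intersections and unions preserve this. In
  terms of complements, a closed set containing \<open>P\<close> contains every point over
  \<open>P\<close>.\<close>

lemma openin_zariski_generization:
  assumes "openin zariski_topology W" "R \<in> W" "P \<subseteq> R" "P \<in> proj_points"
  shows "P \<in> W"
proof -
  have "generate_topology_on {{P \<in> proj_points. f \<notin> P} | f. \<exists>t. form t f} W"
    using assms(1) unfolding zariski_topology_def openin_topology_generated_by_iff .
  then show ?thesis using assms(2)
  proof induction
    case (Basis s)
    then obtain f where "s = {P \<in> proj_points. f \<notin> P}" by blast
    then show ?case using Basis.prems assms(3,4) by auto
  qed auto
qed

text \<open>\<open>P\<close> is the generic point: of two closed sets that cover the given one, the
  set containing \<open>P\<close> is already everything.\<close>

lemma irreducible_closedin_subscheme: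
  assumes P: "P \<in> proj_points" "I \<subseteq> P"
  shows "irreducible_closedin (subscheme_space I) {R \<in> proj_points. I \<subseteq> R \<and> P \<subseteq> R}"
  (is "irreducible_closedin ?T ?Z")
proof -
  have "graded P" using P by (simp add: proj_points_iff)
  have "?Z = {R \<in> proj_points. P \<subseteq> R} \<inter> {R \<in> proj_points. I \<subseteq> R}" by auto
  then have closed: "closedin ?T ?Z"
    unfolding subscheme_space_def closedin_subtopology using closedin_zariski[OF \<open>graded P\<close>]
    by (intro exI[of _ "{R \<in> proj_points. P \<subseteq> R}"] conjI)
  have PZ: "P \<in> ?Z" using P by simp
  have all: "?Z \<subseteq> U" if U: "closedin ?T U" "P \<in> U" for U
  proof
    fix R assume R: "R \<in> ?Z"
    obtain C where C: "closedin zariski_topology C" "U = C \<inter> {R \<in> proj_points. I \<subseteq> R}"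
      using U(1) unfolding subscheme_space_def closedin_subtopology by (elim exE conjE)
    have "R \<in> C"
    proof (rule ccontr)
      assume "R \<notin> C"
      then have RC: "R \<in> topspace zariski_topology - C" using R by (simp add: topspace_zariski)
      have "openin zariski_topology (topspace zariski_topology - C)"
        using C(1) unfolding closedin_def by (rule conjunct2)
      moreover have "P \<subseteq> R" using R by simp
      ultimately have "P \<in> topspace zariski_topology - C"
        by (rule openin_zariski_generization[OF _ RC _ P(1)])
      then show False using U(2) C(2) by simp
    qed
    then show "R \<in> U" using R C(2) by simp
  qed
  have "?Z = U \<or> ?Z = V" if "closedin ?T U" "closedin ?T V" "?Z = U \<union> V" for U V
  proof -
    have "P \<in> U \<union> V" using PZ unfolding that(3) .
    moreover have "U \<subseteq> ?Z" "V \<subseteq> ?Z" unfolding that(3) by (rule Un_upper1, rule Un_upper2)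
    ultimately show ?thesis using all[OF that(1)] all[OF that(2)] by (elim UnE) (simp_all add: equalityI)
  qed
  moreover have "?Z \<noteq> {}" using PZ by (metis empty_iff)
  ultimately show ?thesis unfolding irreducible_closedin_def using closed
    by (intro conjI allI impI)
qed

text \<open>A strict inclusion of points would give a chain of length one of irreducible closed
  sets. Inclusions reverse, so the larger prime \<open>Q\<close> gives the first member of the
  chain.\<close>

lemma zero_dim_incomparable:
  assumes I: "defines_zero_dim_subscheme I"
    and P: "P \<in> proj_points" "I \<subseteq> P" and Q: "Q \<in> proj_points" "P \<subseteq> Q"
  shows "P = Q"
proof (rule ccontr)
  assume ne: "P \<noteq> Q"
  let ?T = "subscheme_space I"
  let ?V = "\<lambda>P. {R \<in> proj_points. I \<subseteq> R \<and> P \<subseteq> R}"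
  let ?Z = "\<lambda>i::nat. if i = 0 then ?V Q else ?V P"
  have "I \<subseteq> Q" using P(2) Q(2) by (rule order_trans)
  have irr: "\<forall>i\<le>1. irreducible_closedin ?T (?Z i)"
    using irreducible_closedin_subscheme[OF P] irreducible_closedin_subscheme[OF Q(1) \<open>I \<subseteq> Q\<close>] by simp
  have "P \<in> ?V P - ?V Q" using P ne Q(2) by auto
  moreover have "?V Q \<subseteq> ?V P" using Q(2) by auto
  ultimately have "?V Q \<subset> ?V P" by blast
  then have "\<forall>i<1. ?Z i \<subset> ?Z (Suc i)" by simp
  then have "\<exists>Z. (\<forall>i\<le>1. irreducible_closedin ?T (Z i)) \<and> (\<forall>i<1. Z i \<subset> Z (Suc i))"
    using irr by (intro exI[of _ ?Z] conjI)
  then have "ereal (real 1) \<le> krull_dim ?T"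
    unfolding krull_dim_def by (intro Sup_upper CollectI exI[of _ "1::nat"] conjI) auto
  then show False using I by (simp add: defines_zero_dim_subscheme_def)
qed

text \<open>Every prime between \<open>I\<close> and a point \<open>Q\<close> contains an associated prime of \<open>I\<close>, which is
  homogeneous and therefore itself a point.\<close>

lemma zero_dim_points_associated:
  fixes I :: "('n::{finite,linorder}, 'k::field) mpoly set"
  assumes I: "is_ideal I" "graded I" "defines_zero_dim_subscheme I"
    and Q: "Q \<in> proj_points" and P: "is_prime P" "I \<subseteq> P" "P \<subseteq> Q"
  shows "P = Q \<and> Q \<in> associated_primes I"
proof -
  \<comment> \<open>With the complement of \<open>P\<close> as multiplicative set, the associated
    prime obtained lies inside \<open>P\<close>. It is homogeneous even though \<open>P\<close> is
    not assumed to be.\<close>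
  have "\<exists>h. is_prime {g. g * (h * 1) \<in> I} \<and> - P \<inter> {g. g * (h * 1) \<in> I} = {}"
  proof (rule exists_associated_prime[OF noetherian_mpoly I(1)])
    show "1 \<in> - P" using is_prime_one[OF P(1)] by simp
    show "a * b \<in> - P" if "a \<in> - P" "b \<in> - P" for a b using is_prime_mult[OF P(1), of a b] that by auto
    show "s * 1 \<notin> I" if "s \<in> - P" for s using that P(2) by auto
  qed
  then obtain h where h: "is_prime {g. g * (h * 1) \<in> I}" "- P \<inter> {g. g * (h * 1) \<in> I} = {}" by auto
  define P' where "P' = {g. g * (h * 1) \<in> I}"
  have P': "is_prime P'" "P' = {g. g * (h * 1) \<in> I}" "P' \<subseteq> P" using h unfolding P'_def by auto
  have "P' \<subseteq> Q" using P'(3) P(3) by (rule order_trans)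
  moreover have "graded P'" by (rule graded_associated_prime[OF I(1,2) P'(1,2)])
  ultimately have "P' \<in> proj_points" using P'(1) Q by (auto simp: proj_points_iff)
  moreover have "I \<subseteq> P'" unfolding P'(2) using is_ideal_mult_right[OF I(1)] by auto
  ultimately have "P' = Q" using zero_dim_incomparable[OF I(3) _ _ Q \<open>P' \<subseteq> Q\<close>] by simp
  moreover have "P' \<in> associated_primes I"
    unfolding associated_primes_eq using P'(1,2) by (intro CollectI conjI exI[of _ "h * 1"])
  ultimately show ?thesis using P'(3) P(3) by auto
qed

text \<open>Every point over \<open>I\<close> equals the member of the finite family below it. That
  member is not known to be homogeneous, which \<open>zero_dim_points_associated\<close>
  allows.\<close>

lemma finite_zero_dim_points:
  fixes I :: "('n::{finite,linorder}, 'k::field) mpoly set"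
  assumes I: "is_ideal I" "graded I" "defines_zero_dim_subscheme I"
  shows "finite {Q \<in> proj_points. I \<subseteq> Q}"
proof -
  from finitely_many_minimal_primes[OF noetherian_mpoly I(1)]
  obtain \<P> where \<P>: "finite \<P>" "\<forall>P\<in>\<P>. is_prime P \<and> I \<subseteq> P"
    "\<forall>Q. is_prime Q \<longrightarrow> I \<subseteq> Q \<longrightarrow> (\<exists>P\<in>\<P>. P \<subseteq> Q)" by (elim exE conjE)
  have "Q \<in> \<P>" if Q: "Q \<in> proj_points" "I \<subseteq> Q" for Q
  proof -
    have "is_prime Q" using Q(1) by (simp add: proj_points_iff)
    then obtain P where P: "P \<in> \<P>" "P \<subseteq> Q" using \<P>(3) Q(2) by auto
    then have "is_prime P" "I \<subseteq> P" using \<P>(2) by auto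
    then have "P = Q" using zero_dim_points_associated[OF I Q(1) _ _ P(2)] by simp
    then show ?thesis using P(1) by simp
  qed
  then show ?thesis by (intro finite_subset[OF _ \<P>(1)]) auto
qed

section \<open>Prime avoidance by forms\<close>

lemma single_eq_mult_var_power:
  assumes "q \<le> Poly_Mapping.lookup a i"
  shows "\<exists>r. Poly_Mapping.single a c = r * (var i :: ('n::finite, 'k::field) mpoly) ^ q"
proof -
  have "a - Poly_Mapping.single i q + Poly_Mapping.single i q = a"
    using assms by (intro poly_mapping_eqI) (auto simp: lookup_add lookup_minus lookup_single when_def)
  then have "Poly_Mapping.single a c = Poly_Mapping.single (a - Poly_Mapping.single i q) c * var i ^ q"
    by (simp add: var_power mult_single)
  then show ?thesis ..
qed

lemma in_ideal_if_monomials: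
  assumes "is_ideal J" "\<And>a. a \<in> Poly_Mapping.keys f \<Longrightarrow> Poly_Mapping.single a (Poly_Mapping.lookup f a) * g \<in> J"
  shows "f * g \<in> (J :: ('n::finite, 'k::field) mpoly set)"
proof -
  have "(\<Sum>a\<in>Poly_Mapping.keys f. Poly_Mapping.single a (Poly_Mapping.lookup f a) * g) \<in> J"
    by (rule is_ideal_sum[OF assms])
  then show ?thesis by (simp add: poly_mapping_sum_single flip: sum_distrib_right)
qed

lemma exists_var_notin:
  assumes P: "is_ideal P" and "\<not> irrelevant_ideal \<subseteq> P"
  shows "\<exists>i. (var i :: ('n::finite, 'k::field) mpoly) \<notin> P"
proof (rule ccontr)
  assume all: "\<not> ?thesis"
  have "f \<in> P" if f: "f \<in> irrelevant_ideal" for f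
  proof -
    have "f * 1 \<in> P"
    proof (rule in_ideal_if_monomials[OF P])
      fix a assume "a \<in> Poly_Mapping.keys f"
      then have "a \<noteq> 0" using f by (auto simp: irrelevant_ideal_def in_keys_iff)
      then obtain i where "Poly_Mapping.lookup a i \<noteq> 0" by (auto simp: poly_mapping_eq_iff fun_eq_iff)
      then have "1 \<le> Poly_Mapping.lookup a i" by simp
      from single_eq_mult_var_power[OF this, of "Poly_Mapping.lookup f a"]
      obtain r :: "('n, 'k) mpoly" where r: "Poly_Mapping.single a (Poly_Mapping.lookup f a) = r * var i ^ 1" ..
      have "r * var i \<in> P" using all by (intro is_ideal_mult[OF P]) auto
      then show "Poly_Mapping.single a (Poly_Mapping.lookup f a) * 1 \<in> P" using r by simp
    qed
    then show ?thesis by simp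
  qed
  then show False using assms(2) by auto
qed

text \<open>Multiply one form from each \<open>Q\<close> lying outside \<open>P\<close>; primeness
  keeps the product outside \<open>P\<close>. A variable outside \<open>P\<close> as starting factor
  makes the degree positive.\<close>

lemma exists_form_in_all_notin:
  assumes "finite \<S>" and P: "P \<in> proj_points"
    and \<S>: "\<And>Q. Q \<in> \<S> \<Longrightarrow> is_ideal Q \<and> graded Q \<and> \<not> Q \<subseteq> P"
  shows "\<exists>t>0. \<exists>f. form t f \<and> f \<notin> P \<and> (\<forall>Q\<in>\<S>. f \<in> Q)"
  using assms(1,3)
proof (induction \<S>)
  case empty
  have "is_ideal P" "\<not> irrelevant_ideal \<subseteq> P" using P by (auto simp: proj_points_iff is_prime_ideal)
  from exists_var_notin[OF this] obtain i where "var i \<notin> P" ..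
  then show ?case using form_var[of i] by (intro exI[of _ 1] conjI exI[of _ "var i"]) auto
next
  case (insert Q \<S>)
  have prime: "is_prime P" using P by (simp add: proj_points_iff)
  have Q: "graded Q" "is_ideal Q" "\<not> Q \<subseteq> P" using insert.prems by auto
  have "\<exists>t>0. \<exists>f. form t f \<and> f \<notin> P \<and> (\<forall>Q\<in>\<S>. f \<in> Q)" using insert.prems by (intro insert.IH) auto
  then obtain t f where f: "t > 0" "form t f" "f \<notin> P" "\<forall>Q\<in>\<S>. f \<in> Q" by auto
  from exists_form_notin[OF Q(1) is_prime_ideal[OF prime] Q(3)]
  obtain s g where g: "form s g" "g \<in> Q" "g \<notin> P" by auto
  have "f * g \<notin> P" using is_prime_mult[OF prime, of f g] f(3) g(3) by auto
  moreover have "f * g \<in> R" if R: "R \<in> insert Q \<S>" for R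
  proof (cases "R = Q")
    case True
    then show ?thesis using is_ideal_mult[OF Q(2) g(2)] by simp
  next
    case False
    then have "f \<in> R" "is_ideal R" using R f(4) insert.prems by auto
    then show ?thesis by (simp add: is_ideal_mult_right)
  qed
  ultimately show ?case using form_mult[OF f(2) g(1)] f(1)
    by (intro exI[of _ "t + s"] conjI exI[of _ "f * g"]) auto
qed

text \<open>If a form \<open>g\<close> of degree \<open>a\<close> avoids the other primes but lies
  in \<open>P\<close>, take \<open>h\<close> of degree \<open>b\<close> in all the others and
  outside \<open>P\<close>. Then \<open>g ^ b + h ^ a\<close> avoids them all, the exponents making
  both terms forms of degree \<open>a * b\<close>.\<close>

lemma homogeneous_prime_avoidance:
  assumes "finite \<S>" "\<S> \<subseteq> proj_points"
    and "\<And>P Q. P \<in> \<S> \<Longrightarrow> Q \<in> \<S> \<Longrightarrow> P \<subseteq> Q \<Longrightarrow> P = Q"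
  shows "\<exists>t>0. \<exists>f. form t (f :: ('n::finite, 'k::field) mpoly) \<and> (\<forall>P\<in>\<S>. f \<notin> P)"
  using assms
proof (induction \<S>)
  case empty
  show ?case using form_var[of undefined] by (intro exI[of _ 1] conjI exI[of _ "var undefined"]) auto
next
  case (insert P \<S>)
  have P: "P \<in> proj_points" using insert.prems by auto
  then have prime: "is_prime P" by (simp add: proj_points_iff)
  note P' = is_prime_ideal[OF prime]
  have pS: "is_prime Q" "graded Q" if "Q \<in> \<S>" for Q
    using that insert.prems(1) by (auto simp: proj_points_iff)
  have "\<exists>t>0. \<exists>f. form t (f :: ('n, 'k) mpoly) \<and> (\<forall>P\<in>\<S>. f \<notin> P)"
    using insert.prems by (intro insert.IH) auto
  then obtain a g where g: "a > 0" "form a g" "\<forall>Q\<in>\<S>. g \<notin> Q" by auto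
  show ?case
  proof (cases "g \<in> P")
    case False
    then show ?thesis using g by (intro exI[of _ a] conjI exI[of _ g]) auto
  next
    case True
    have "\<exists>b>0. \<exists>f. form b f \<and> f \<notin> P \<and> (\<forall>Q\<in>\<S>. f \<in> Q)"
    proof (rule exists_form_in_all_notin[OF insert.hyps(1) P])
      fix Q assume Q: "Q \<in> \<S>"
      then have "\<not> Q \<subseteq> P" using insert.prems(2)[of Q P] insert.hyps(2) by auto
      then show "is_ideal Q \<and> graded Q \<and> \<not> Q \<subseteq> P" using pS[OF Q] is_prime_ideal by auto
    qed
    then obtain b h where h: "b > 0" "form b h" "h \<notin> P" "\<forall>Q\<in>\<S>. h \<in> Q" by auto
    have pow: "x ^ n \<in> J" if "is_ideal J" "x \<in> J" "n > 0" for x n and J :: "('n, 'k) mpoly set"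
      using that by (cases n) (auto intro: is_ideal_mult_right)
    have "form (a * b) (g ^ b + h ^ a)"
      using form_add[OF form_power[OF g(2), of b]] form_power[OF h(2), of a] by (simp add: mult.commute)
    moreover have "g ^ b + h ^ a \<notin> P"
    proof
      assume "g ^ b + h ^ a \<in> P"
      from is_ideal_diff[OF P' this pow[OF P' True h(1)]] have "h ^ a \<in> P" by simp
      then show False using is_prime_power[OF prime] h(3) by auto
    qed
    moreover have "g ^ b + h ^ a \<notin> Q" if Q: "Q \<in> \<S>" for Q
    proof
      note Q' = is_prime_ideal[OF pS(1)[OF Q]]
      have "h \<in> Q" using h(4) Q by simp
      assume "g ^ b + h ^ a \<in> Q"
      from is_ideal_diff[OF Q' this pow[OF Q' \<open>h \<in> Q\<close> g(1)]] have "g ^ b \<in> Q" by simp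
      then show False using is_prime_power[OF pS(1)[OF Q]] g(3) Q by auto
    qed
    ultimately show ?thesis using g(1) h(1)
      by (intro exI[of _ "a * b"] conjI exI[of _ "g ^ b + h ^ a"]) auto
  qed
qed

section \<open>Symbolic powers compared with saturations\<close>

lemma power_in_ideal_power: "x \<in> I \<Longrightarrow> x ^ m \<in> ideal_power I m"
proof (induction m)
  case (Suc m)
  then show ?case using ideal_power_Suc_mult[of "x ^ m" I m x] by (simp add: mult.commute)
qed (simp add: ideal_power_0)

text \<open>Pigeonhole: a monomial whose degree is at least the sum of the \<open>q i\<close> is
  divisible by one of the \<open>var i ^ q i\<close>.\<close>

lemma saturationI:
  fixes J :: "('n::finite, 'k::field) mpoly set"
  assumes J: "is_ideal J" and q: "\<And>i. var i ^ q i * f \<in> J"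
  shows "f \<in> saturation J"
proof -
  have "c * f \<in> J" if c: "form t c" "(\<Sum>i\<in>UNIV. q i) \<le> t" for c t
  proof (rule in_ideal_if_monomials[OF J])
    fix a assume "a \<in> Poly_Mapping.keys c"
    then have a: "mon_degree a = t" using c(1) by (simp add: form_def)
    have "\<exists>i. q i \<le> Poly_Mapping.lookup a i"
    proof (rule ccontr)
      assume "\<not> ?thesis"
      then have "mon_degree a < (\<Sum>i\<in>UNIV. q i)"
        unfolding mon_degree_def by (intro sum_strict_mono) (auto simp: not_le)
      then show False using a c(2) by simp
    qed
    then obtain i where "q i \<le> Poly_Mapping.lookup a i" ..
    from single_eq_mult_var_power[OF this, of "Poly_Mapping.lookup c a"]
    obtain r :: "('n, 'k) mpoly" where r: "Poly_Mapping.single a (Poly_Mapping.lookup c a) = r * var i ^ q i" ..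
    show "Poly_Mapping.single a (Poly_Mapping.lookup c a) * f \<in> J"
      unfolding r mult.assoc by (rule is_ideal_mult[OF J q])
  qed
  then show ?thesis unfolding saturation_def by blast
qed

text \<open>If no power of a variable multiplied \<open>f\<close> into \<open>I^m\<close>, some
  associated prime \<open>Q\<close> of \<open>I^m\<close> would contain every multiplier of
  \<open>f\<close> into \<open>I^m\<close> and avoid that variable. Being homogeneous,
  \<open>Q\<close> would be a point over \<open>I\<close>, hence associated to \<open>I\<close>, yet
  it would contain the multiplier \<open>s\<close>.\<close>

lemma symbolic_power_subset_saturation:
  fixes I :: "('n::{finite,linorder}, 'k::field) mpoly set"
  assumes I: "is_ideal I" "graded I" "defines_zero_dim_subscheme I" "1 \<notin> I"
  shows "symbolic_power I m \<subseteq> saturation (ideal_power I m)"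
proof
  note Im = is_ideal_ideal_power[OF I(1), of m]
  fix f assume "f \<in> symbolic_power I m"
  then obtain s where s: "s \<in> - \<Union>(associated_primes I)" "s * f \<in> ideal_power I m"
    unfolding symbolic_power_iff[OF I(1,4)] ..
  have "\<exists>q. var i ^ q * f \<in> ideal_power I m" for i
  proof (rule ccontr)
    assume no: "\<not> ?thesis"
    have "\<exists>h. is_prime {g. g * (h * f) \<in> ideal_power I m} \<and>
      range (\<lambda>q. var i ^ q) \<inter> {g. g * (h * f) \<in> ideal_power I m} = {}"
    proof (rule exists_associated_prime[OF noetherian_mpoly Im])
      show "1 \<in> range (\<lambda>q. var i ^ q :: ('n, 'k) mpoly)" by (rule range_eqI[of _ _ 0]) simp
      show "a * b \<in> range (\<lambda>q. var i ^ q)"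
        if ab: "a \<in> range (\<lambda>q. var i ^ q)" "b \<in> range (\<lambda>q. var i ^ q)" for a b :: "('n, 'k) mpoly"
      proof -
        obtain q q' where "a = var i ^ q" "b = var i ^ q'" using ab by auto
        then show ?thesis by (intro range_eqI[of _ _ "q + q'"]) (simp add: power_add)
      qed
      show "x * f \<notin> ideal_power I m" if "x \<in> range (\<lambda>q. var i ^ q)" for x using no that by auto
    qed
    then obtain h where h: "is_prime {g. g * (h * f) \<in> ideal_power I m}"
      "range (\<lambda>q. var i ^ q) \<inter> {g. g * (h * f) \<in> ideal_power I m} = {}" by auto
    define Q where "Q = {g. g * (h * f) \<in> ideal_power I m}"
    have Q: "is_prime Q" using h(1) by (simp add: Q_def)
    have "graded Q" by (rule graded_associated_prime[OF Im graded_ideal_power[OF I(1,2)] Q Q_def])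
    have "var i \<notin> Q"
    proof
      assume "var i \<in> Q"
      moreover have "var i \<in> range (\<lambda>q. var i ^ q :: ('n, 'k) mpoly)" by (rule range_eqI[of _ _ 1]) simp
      ultimately show False using h(2) unfolding Q_def by auto
    qed
    moreover have "var i \<in> irrelevant_ideal"
    proof -
      have "Poly_Mapping.single i 1 \<noteq> (0 :: 'n \<Rightarrow>\<^sub>0 nat)"
        by (metis lookup_single_eq lookup_zero one_neq_zero)
      then show ?thesis by (simp add: irrelevant_ideal_def var_def lookup_single)
    qed
    ultimately have "\<not> irrelevant_ideal \<subseteq> Q" by auto
    then have "Q \<in> proj_points" using Q \<open>graded Q\<close> by (simp add: proj_points_iff)
    moreover have "I \<subseteq> Q"
    proof
      fix x assume "x \<in> I"
      then have "x ^ m * (h * f) \<in> ideal_power I m"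
        by (intro is_ideal_mult_right[OF Im] power_in_ideal_power)
      then have "x ^ m \<in> Q" by (simp add: Q_def)
      then show "x \<in> Q" by (rule is_prime_power[OF Q])
    qed
    ultimately have "Q \<in> associated_primes I"
      using zero_dim_points_associated[OF I(1-3) _ Q] by simp
    moreover have "s \<in> Q"
      using is_ideal_mult[OF Im s(2), of h] by (simp add: Q_def ac_simps)
    ultimately show False using s(1) by auto
  qed
  then obtain q where "\<And>i. var i ^ q i * f \<in> ideal_power I m" by metis
  then show "f \<in> saturation (ideal_power I m)" by (rule saturationI[OF Im])
qed

text \<open>In degree \<open>t\<close>, \<open>s * f\<close> equals the constant term of
  \<open>s\<close> times \<open>hcomp t f\<close>, plus terms with lower components of
  \<open>f\<close>. Induction on \<open>t\<close> then divides by a nonzero constant. It applies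
  when the irrelevant ideal is associated, since then every denominator has a constant term.\<close>

lemma ideal_cancel_nonzero_constant:
  fixes J :: "('n::finite, 'k::field) mpoly set"
  assumes J: "is_ideal J" "graded J" and s: "s \<notin> irrelevant_ideal" "s * f \<in> J"
  shows "f \<in> J"
proof -
  have "hcomp t f \<in> J" for t
  proof (induction t rule: less_induct)
    case (less t)
    have "hcomp t (s * f) = hcomp 0 s * hcomp t f + (\<Sum>i\<in>{..t} - {0}. hcomp i s * hcomp (t - i) f)"
      unfolding hcomp_mult by (subst sum.remove[of _ 0]) auto
    moreover have "(\<Sum>i\<in>{..t} - {0}. hcomp i s * hcomp (t - i) f) \<in> J"
    proof (rule is_ideal_sum[OF J(1)])
      fix i assume "i \<in> {..t} - {0}"
      then show "hcomp i s * hcomp (t - i) f \<in> J" by (intro is_ideal_mult[OF J(1)] less) auto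
    qed
    moreover have "hcomp t (s * f) \<in> J" by (rule gradedD[OF J(2) s(2)])
    ultimately have "hcomp 0 s * hcomp t f \<in> J"
      using is_ideal_diff[OF J(1), of "hcomp t (s * f)"] by fastforce
    then have "Poly_Mapping.single 0 (inverse (Poly_Mapping.lookup s 0)) * (hcomp 0 s * hcomp t f) \<in> J"
      by (rule is_ideal_mult[OF J(1)])
    moreover have "Poly_Mapping.lookup s 0 \<noteq> 0" using s(1) by (simp add: irrelevant_ideal_def)
    ultimately show ?case
      by (simp add: hcomp_0_eq mult_single flip: mult.assoc)
  qed
  obtain S where "(\<Sum>t\<in>S. hcomp t f) = f" by (rule obtain_sum_hcomp[of f])
  moreover have "(\<Sum>t\<in>S. hcomp t f) \<in> J" using \<open>\<And>t. hcomp t f \<in> J\<close> by (rule is_ideal_sum[OF J(1)])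
  ultimately show ?thesis by simp
qed

text \<open>If the irrelevant ideal is associated to \<open>I\<close>, then \<open>I\<^sup>(\<^sup>m\<^sup>) = I\<^sup>m\<close>; otherwise a form avoiding the
  finitely many points is invertible in the localization, and \<open>I\<^sup>(\<^sup>m\<^sup>)\<close> is the saturation of \<open>I\<^sup>m\<close>.\<close>

lemma graded_symbolic_power:
  fixes I :: "('n::{finite,linorder}, 'k::field) mpoly set"
  assumes I: "is_ideal I" "graded I" "defines_zero_dim_subscheme I" "1 \<notin> I"
  shows "graded (symbolic_power I m)"
proof (cases "irrelevant_ideal \<in> associated_primes I")
  case True
  have "symbolic_power I m \<subseteq> ideal_power I m"
  proof
    fix f assume "f \<in> symbolic_power I m"
    then obtain s where s: "s \<in> - \<Union>(associated_primes I)" "s * f \<in> ideal_power I m"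
      unfolding symbolic_power_iff[OF I(1,4)] ..
    have "s \<notin> irrelevant_ideal"
    proof
      assume "s \<in> irrelevant_ideal"
      with True have "s \<in> \<Union>(associated_primes I)" by (rule UnionI)
      with s(1) show False by (rule ComplD[THEN notE])
    qed
    then show "f \<in> ideal_power I m"
      using s(2) by (rule ideal_cancel_nonzero_constant[OF is_ideal_ideal_power[OF I(1)] graded_ideal_power[OF I(1,2)]])
  qed
  then have "symbolic_power I m = ideal_power I m"
    using ideal_power_subset_symbolic_power[OF I(1,4)] by (rule equalityI)
  then show ?thesis using graded_ideal_power[OF I(1,2)] by simp
next
  case False
  let ?V = "{Q \<in> proj_points. I \<subseteq> Q}"
  \<comment> \<open>A homogeneous prime lies in the irrelevant ideal, so it can fail to be a point
    only by being equal to it.\<close>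
  have sub: "associated_primes I \<subseteq> ?V"
  proof
    fix P assume PA: "P \<in> associated_primes I"
    then obtain f where P: "is_prime P" "P = {g. g * f \<in> I}" by (auto simp: associated_primes_eq)
    have gr: "graded P" by (rule graded_associated_prime[OF I(1,2) P])
    have "P \<noteq> irrelevant_ideal" using PA False by auto
    then have "\<not> irrelevant_ideal \<subseteq> P"
      using graded_subset_irrelevant[OF is_prime_ideal[OF P(1)] gr is_prime_one[OF P(1)]] by auto
    moreover have "I \<subseteq> P" unfolding P(2) using is_ideal_mult_right[OF I(1)] by auto
    ultimately show "P \<in> ?V" using P(1) gr by (simp add: proj_points_iff)
  qed
  have "\<exists>t>0. \<exists>f. form t (f :: ('n, 'k) mpoly) \<and> (\<forall>P\<in>?V. f \<notin> P)"
  proof (rule homogeneous_prime_avoidance)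
    show "finite ?V" by (rule finite_zero_dim_points[OF I(1-3)])
    show "?V \<subseteq> proj_points" by auto
    show "P = Q" if "P \<in> ?V" "Q \<in> ?V" "P \<subseteq> Q" for P Q
      using that by (intro zero_dim_incomparable[OF I(3)]) simp_all
  qed
  then obtain t l where l: "t > 0" "form t l" "\<forall>P\<in>?V. l \<notin> P" by auto
  have "saturation (ideal_power I m) \<subseteq> symbolic_power I m"
  proof
    fix f assume "f \<in> saturation (ideal_power I m)"
    then obtain q where q: "\<forall>c t. form t c \<longrightarrow> q \<le> t \<longrightarrow> c * f \<in> ideal_power I m"
      by (auto simp: saturation_def)
    \<comment> \<open>The positive degree of \<open>l\<close> lets its powers reach the saturation
      exponent \<open>q\<close> while staying outside all associated primes.\<close>
    have "form (t * q) (l ^ q)" "q \<le> t * q" using form_power[OF l(2)] l(1) by auto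
    with q have "l ^ q * f \<in> ideal_power I m" by simp
    moreover have "l ^ q \<in> - \<Union>(associated_primes I)"
    proof
      assume "l ^ q \<in> \<Union>(associated_primes I)"
      then obtain P where "P \<in> associated_primes I" and lP: "l ^ q \<in> P" by (rule UnionE)
      note P = subsetD[OF sub this(1)] lP
      then have "is_prime P" using P(1) by (simp add: proj_points_iff)
      then have "l \<in> P" using P(2) by (rule is_prime_power)
      then show False using l(3) P(1) by simp
    qed
    ultimately show "f \<in> symbolic_power I m" unfolding symbolic_power_iff[OF I(1,4)] by (rule bexI)
  qed
  with symbolic_power_subset_saturation[OF I]
  have "symbolic_power I m = saturation (ideal_power I m)" by (rule equalityI)
  then show ?thesis using graded_saturation[OF graded_ideal_power[OF I(1,2)]] by simp
qed

section \<open>The ideal of a zero-dimensional subscheme is proper and nonzero\<close>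

lemma zero_dim_one_notin:
  assumes "defines_zero_dim_subscheme I"
  shows "1 \<notin> I"
proof -
  have "{P \<in> proj_points. I \<subseteq> P} \<noteq> {}"
    using assms by (simp add: defines_zero_dim_subscheme_def topspace_subscheme_space)
  then obtain P where "P \<in> proj_points" "I \<subseteq> P" by auto
  then show ?thesis using is_prime_one[of P] by (auto simp: proj_points_iff)
qed

text \<open>Every monomial of a multiple of \<open>var j\<close> involves the variable
  \<open>j\<close>, which a power of another variable does not.\<close>

lemma var_power_notin_principal:
  assumes "i \<noteq> j"
  shows "(var i :: ('n::finite, 'k::field) mpoly) ^ q \<notin> lspan UNIV {var j}"
proof
  let ?J = "{f :: ('n, 'k) mpoly. \<forall>a. Poly_Mapping.lookup a j = 0 \<longrightarrow> Poly_Mapping.lookup f a = 0}"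
  assume "var i ^ q \<in> lspan UNIV {var j :: ('n, 'k) mpoly}"
  then have "var i ^ q \<in> ?J"
  proof (rule lspan_closed)
    fix r x :: "('n, 'k) mpoly" assume "x \<in> {var j}"
    show "r * x \<in> ?J"
    proof (intro CollectI allI impI)
      fix a :: "'n \<Rightarrow>\<^sub>0 nat" assume a: "Poly_Mapping.lookup a j = 0"
      have "Poly_Mapping.lookup (r * x) a \<in> {0}"
      proof (rule lookup_mult_in_ideal)
        fix b c :: "'n \<Rightarrow>\<^sub>0 nat" assume "b + c = a"
        then have "Poly_Mapping.lookup c j = 0" using a by (auto simp: lookup_add)
        then have "c \<noteq> Poly_Mapping.single j 1" by auto
        then show "Poly_Mapping.lookup r b * Poly_Mapping.lookup x c \<in> {0}"
          using \<open>x \<in> {var j}\<close> by (simp add: var_def lookup_single when_def)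
      qed (simp add: is_ideal_def)
      then show "Poly_Mapping.lookup (r * x) a = 0" by simp
    qed
  qed (auto simp: lookup_add)
  then show False using assms
    by (auto simp: var_power lookup_single when_def split: if_splits dest!: spec[of _ "Poly_Mapping.single i q"])
qed

text \<open>For \<open>I = 0\<close>, a homogeneous prime containing \<open>var j\<close> and
  avoiding the powers of \<open>var i\<close> is a point strictly above the prime \<open>0\<close>,
  contrary to dimension zero. Two variables are essential: on a single point the zero ideal does
  define a zero-dimensional scheme.\<close>

lemma zero_dim_nonzero:
  fixes I :: "('n::{finite,linorder}, 'k::field) mpoly set"
  assumes I: "is_ideal I" "graded I" "defines_zero_dim_subscheme I" and card: "CARD('n) \<ge> 2"
  shows "\<exists>f\<in>I. f \<noteq> 0"
proof (rule ccontr)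
  assume "\<not> ?thesis"
  then have I0: "I = {0}" using is_ideal_zero[OF I(1)] by auto
  have "\<not> CARD('n) \<le> Suc 0" using card by simp
  then obtain i j :: 'n where ij: "i \<noteq> j" using card_le_Suc0_iff_eq[of "UNIV :: 'n set"] by auto
  define K where "K = lspan UNIV {var j :: ('n, 'k) mpoly}"
  have K: "is_ideal K" "graded K"
    unfolding K_def using form_var[of j] by (auto intro!: is_ideal_lspan graded_lspan_forms)
  have "\<exists>h. is_prime {g. g * (h * 1) \<in> K} \<and> range (\<lambda>q. var i ^ q) \<inter> {g. g * (h * 1) \<in> K} = {}"
  proof (rule exists_associated_prime[OF noetherian_mpoly K(1)])
    show "1 \<in> range (\<lambda>q. var i ^ q :: ('n, 'k) mpoly)" by (rule range_eqI[of _ _ 0]) simp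
    show "a * b \<in> range (\<lambda>q. var i ^ q)"
      if ab: "a \<in> range (\<lambda>q. var i ^ q)" "b \<in> range (\<lambda>q. var i ^ q)" for a b :: "('n, 'k) mpoly"
    proof -
      obtain q q' where "a = var i ^ q" "b = var i ^ q'" using ab by auto
      then show ?thesis by (intro range_eqI[of _ _ "q + q'"]) (simp add: power_add)
    qed
    show "x * 1 \<notin> K" if "x \<in> range (\<lambda>q. var i ^ q)" for x
      using that var_power_notin_principal[OF ij] by (auto simp: K_def)
  qed
  then obtain h where h: "is_prime {g. g * (h * 1) \<in> K}"
    "range (\<lambda>q. var i ^ q) \<inter> {g. g * (h * 1) \<in> K} = {}" by auto
  define Q where "Q = {g. g * (h * 1) \<in> K}"
  have Q: "is_prime Q" using h(1) by (simp add: Q_def)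
  have "graded Q" by (rule graded_associated_prime[OF K Q Q_def])
  have "var i \<notin> Q"
  proof
    assume "var i \<in> Q"
    moreover have "var i \<in> range (\<lambda>q. var i ^ q :: ('n, 'k) mpoly)" by (rule range_eqI[of _ _ 1]) simp
    ultimately show False using h(2) unfolding Q_def by auto
  qed
  moreover have "var i \<in> irrelevant_ideal"
  proof -
    have "Poly_Mapping.single i 1 \<noteq> (0 :: 'n \<Rightarrow>\<^sub>0 nat)"
      by (metis lookup_single_eq lookup_zero one_neq_zero)
    then show ?thesis by (simp add: irrelevant_ideal_def var_def lookup_single)
  qed
  ultimately have "\<not> irrelevant_ideal \<subseteq> Q" by auto
  then have "Q \<in> proj_points" using Q \<open>graded Q\<close> by (simp add: proj_points_iff)
  moreover have "is_prime {0 :: ('n, 'k) mpoly}" by (auto simp: is_prime_def is_ideal_def)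
  moreover have "{0} \<subseteq> Q" using is_ideal_zero[OF is_prime_ideal[OF Q]] by simp
  ultimately have "{0} = Q" using zero_dim_points_associated[OF I, of Q "{0}"] I0 by simp
  moreover have "var j \<in> Q"
  proof -
    have "var j \<in> K" unfolding K_def by (rule lspan_base[OF ring_closed_UNIV]) simp
    then show ?thesis unfolding Q_def using is_ideal_mult_right[OF K(1)] by simp
  qed
  ultimately have "var j = (0 :: ('n, 'k) mpoly)" by auto
  moreover have "(var j :: ('n, 'k) mpoly) ^ 1 \<notin> lspan UNIV {var i}"
    by (rule var_power_notin_principal[OF ij[symmetric]])
  ultimately show False by (simp add: lspan.zero)
qed

section \<open>Asymptotics of the initial degree\<close>

text \<open>Fekete's lemma: the limit is the infimum of the quotients. Hence \<open>gamma I\<close>,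
  defined by \<open>lim\<close>, bounds every single quotient from below.\<close>

lemma subadditive_limit:
  fixes a :: "nat \<Rightarrow> nat"
  assumes sub: "\<And>m n. a (m + n) \<le> a m + a n"
  obtains L where "(\<lambda>n. real (a n) / real n) \<longlonglongrightarrow> L" "\<And>n. n > 0 \<Longrightarrow> L \<le> real (a n) / real n"
proof -
  let ?f = "\<lambda>n. real (a n) / real n"
  define L where "L = Inf (?f ` {0<..})"
  have bdd: "bdd_below (?f ` {0<..})" by (rule bdd_belowI[of _ 0]) auto
  have L: "L \<le> ?f n" if "n > 0" for n
    unfolding L_def using that by (intro cInf_lower bdd) auto
  have "(\<lambda>n. ?f n) \<longlonglongrightarrow> L"
  proof (rule LIMSEQ_I)
    fix e :: real assume e: "e > 0"
    have "\<exists>x\<in>?f ` {0<..}. x < L + e / 2"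
      unfolding L_def using e by (intro cInf_lessD) auto
    then obtain m where m: "m > 0" "?f m < L + e / 2" by auto
    \<comment> \<open>Division with remainder by \<open>m\<close> reduces \<open>a n\<close> to
      multiples of \<open>a m\<close> and one remainder term, which \<open>B\<close> bounds.\<close>
    define B where "B = (\<Sum>r<m. a r)"
    have B: "a r \<le> B" if "r < m" for r unfolding B_def using that by (intro member_le_sum) auto
    have mult: "a (k * m + r) \<le> k * a m + a r" for k r
    proof (induction k)
      case (Suc k)
      have "a (Suc k * m + r) = a (m + (k * m + r))" by (simp add: add.assoc)
      also have "\<dots> \<le> a m + a (k * m + r)" by (rule sub)
      finally show ?case using Suc by simp
    qed simp
    \<comment> \<open>Beyond \<open>M\<close> the remainder contributes less than
      \<open>e / 2\<close> to the quotient.\<close>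
    obtain M :: nat where M: "real B * 2 / e < real M" using reals_Archimedean2 by blast
    have "norm (?f n - L) < e" if n: "n \<ge> Suc M" for n
    proof -
      have n0: "real n > 0" using n by simp
      have "a n \<le> (n div m) * a m + a (n mod m)" using mult[of "n div m" "n mod m"] by simp
      also have "\<dots> \<le> (n div m) * a m + B" using B[of "n mod m"] m(1) by simp
      finally have "real (a n) \<le> real ((n div m) * a m + B)" by (simp only: of_nat_le_iff)
      then have 1: "real (a n) \<le> real (n div m) * real (a m) + real B" by simp
      have "real (n div m) * real m \<le> real n"
        by (metis div_times_less_eq_dividend of_nat_le_iff of_nat_mult)
      then have "real (n div m) * real m * ?f m \<le> real n * ?f m" by (rule mult_right_mono) simp
      moreover have "real (n div m) * real m * ?f m = real (n div m) * real (a m)" using m(1) by simp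
      ultimately have 2: "real (a n) \<le> real n * ?f m + real B" using 1 by linarith
      have "real B * 2 / e < real n" using M n by linarith
      then have "real B < real n * (e / 2)" using e by (simp add: field_simps)
      moreover have "real n * ?f m < real n * (L + e / 2)" using m(2) n0 by (rule mult_strict_left_mono)
      ultimately have "real (a n) < real n * (L + e / 2) + real n * (e / 2)" using 2 by linarith
      also have "\<dots> = real n * (L + e)" by (simp add: algebra_simps)
      finally have "?f n < L + e" using n0 by (simp add: pos_divide_less_eq mult.commute)
      moreover have "L \<le> ?f n" using n by (intro L) simp
      ultimately show ?thesis by simp
    qed
    then show "\<exists>no. \<forall>n\<ge>no. norm (?f n - L) < e" by blast
  qed
  then show ?thesis using L by (rule that)
qed

lemma exists_nonzero_form:
  assumes "graded J" "f \<in> J" "f \<noteq> 0"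
  shows "\<exists>g\<in>J. g \<noteq> 0 \<and> (\<exists>t. form t g)"
proof (rule ccontr)
  assume no: "\<not> ?thesis"
  have "hcomp t f = 0" for t using no gradedD[OF assms(1,2), of t] form_hcomp[of t f] by auto
  moreover obtain S where "(\<Sum>t\<in>S. hcomp t f) = f" by (rule obtain_sum_hcomp[of f])
  ultimately show False using assms(3) by simp
qed

lemma alpha_attained:
  assumes "g \<in> J" "g \<noteq> 0" "form t g"
  shows "\<exists>f\<in>J. f \<noteq> 0 \<and> form (alpha J) f"
  unfolding alpha_def by (rule LeastI[of "\<lambda>t. \<exists>f\<in>J. f \<noteq> 0 \<and> form t f" t]) (use assms in blast)

lemma alpha_le: "g \<in> J \<Longrightarrow> g \<noteq> 0 \<Longrightarrow> form t g \<Longrightarrow> alpha J \<le> t"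
  unfolding alpha_def by (rule Least_le) blast

context
  fixes I :: "('n::{finite,linorder}, 'k::field) mpoly set"
  assumes I: "is_ideal I" "graded I" "1 \<notin> I" and nz: "\<exists>f\<in>I. f \<noteq> 0"
begin

lemma symbolic_power_alpha_attained:
  "\<exists>f\<in>symbolic_power I m. f \<noteq> 0 \<and> form (alpha (symbolic_power I m)) f"
proof -
  obtain f where "f \<in> I" "f \<noteq> 0" using nz by auto
  from exists_nonzero_form[OF I(2) this] obtain g t where g: "g \<in> I" "g \<noteq> 0" "form t g" by auto
  have "g ^ m \<in> symbolic_power I m"
    using ideal_power_subset_symbolic_power[OF I(1,3)] power_in_ideal_power[OF g(1)] by (rule subsetD)
  moreover have "g ^ m \<noteq> 0" using g(2) by simp
  moreover have "form (t * m) (g ^ m)" by (rule form_power[OF g(3)])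
  ultimately show ?thesis by (rule alpha_attained)
qed

lemma symbolic_power_alpha_ge: "m \<le> alpha (symbolic_power I m)"
proof -
  obtain f where "f \<in> symbolic_power I m" "f \<noteq> 0" "form (alpha (symbolic_power I m)) f"
    using symbolic_power_alpha_attained[of m] by auto
  then show ?thesis using symbolic_power_form_degree[OF I(1,3,2)] by simp
qed

lemma symbolic_power_alpha_subadditive:
  "alpha (symbolic_power I (m + n)) \<le> alpha (symbolic_power I m) + alpha (symbolic_power I n)"
proof -
  obtain f where f: "f \<in> symbolic_power I m" "f \<noteq> 0" "form (alpha (symbolic_power I m)) f"
    using symbolic_power_alpha_attained[of m] by auto
  obtain g where g: "g \<in> symbolic_power I n" "g \<noteq> 0" "form (alpha (symbolic_power I n)) g"
    using symbolic_power_alpha_attained[of n] by auto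
  have "f * g \<noteq> 0" using f(2) g(2) by simp
  with symbolic_power_mult[OF I(1,3) f(1) g(1)] show ?thesis
    by (rule alpha_le) (rule form_mult[OF f(3) g(3)])
qed

text \<open>As \<open>I\<close> is nonzero, one of its generators of degree at most
  \<open>omega I\<close> is nonzero. This yields \<open>gamma I \<le> omega I\<close>.\<close>

lemma symbolic_power_alpha_1_le_omega: "alpha (symbolic_power I 1) \<le> omega I"
proof -
  have "\<exists>f\<in>I. f \<noteq> 0 \<and> (\<exists>d\<le>omega I. form d f)"
  proof (rule ccontr)
    assume "\<not> ?thesis"
    then have "{f \<in> I. \<exists>d\<le>omega I. form d f} \<subseteq> {0}" by auto
    then have "lspan UNIV {f \<in> I. \<exists>d\<le>omega I. form d f} \<subseteq> {0}"
      by (intro lspan_ideal) (simp add: is_ideal_def)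
    then have "I \<subseteq> {0}" using omega_generates[OF I(1,2)] by simp
    then show False using nz by auto
  qed
  then obtain f d where f: "f \<in> I" "f \<noteq> 0" "d \<le> omega I" "form d f" by auto
  have "f \<in> ideal_power I 1" using f(1) ideal_power_one[OF I(1)] by simp
  with ideal_power_subset_symbolic_power[OF I(1,3)] have "f \<in> symbolic_power I 1" by (rule subsetD)
  then have "alpha (symbolic_power I 1) \<le> d" using f(2,4) by (rule alpha_le)
  then show ?thesis using f(3) by simp
qed

lemma gamma_bounds:
  shows gamma_ge_1: "1 \<le> gamma I"
    and gamma_le_omega: "gamma I \<le> real (omega I)"
    and gamma_le: "real m * gamma I \<le> real (alpha (symbolic_power I m))"
proof -
  obtain L where L: "(\<lambda>n. real (alpha (symbolic_power I n)) / real n) \<longlonglongrightarrow> L"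
    "\<And>n. n > 0 \<Longrightarrow> L \<le> real (alpha (symbolic_power I n)) / real n"
    by (rule subadditive_limit[of "\<lambda>n. alpha (symbolic_power I n)"])
      (rule symbolic_power_alpha_subadditive, blast)
  have gL: "gamma I = L" unfolding gamma_def using L(1) by (rule limI)
  have "1 \<le> real (alpha (symbolic_power I n)) / real n" if "n \<ge> 1" for n
    using symbolic_power_alpha_ge[of n] that by (simp add: le_divide_eq)
  then show "1 \<le> gamma I" unfolding gL by (intro LIMSEQ_le_const[OF L(1)] exI[of _ 1] allI impI)
  show "real m * gamma I \<le> real (alpha (symbolic_power I m))"
    using L(2)[of m] unfolding gL by (cases "m = 0") (auto simp: le_divide_eq mult.commute)
  have "L \<le> real (alpha (symbolic_power I 1))" using L(2)[of 1] by simp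
  then show "gamma I \<le> real (omega I)" unfolding gL using symbolic_power_alpha_1_le_omega by linarith
qed

end

theorem symbolic_power_subset_ideal_power:
  fixes I :: "('n::{finite,linorder}, 'k::field) mpoly set"
  assumes I: "is_ideal I" "graded I" "defines_zero_dim_subscheme I" and nz: "\<exists>f\<in>I. f \<noteq> 0"
  shows "\<exists>e::nat. \<forall>m r. r \<le> m \<longrightarrow> real (omega I) * real r + real e \<le> real m * gamma I \<longrightarrow>
    symbolic_power I m \<subseteq> ideal_power I r"
proof -
  note one = zero_dim_one_notin[OF I(3)]
  from saturation_bound[OF I(1,2)] obtain e where
    e: "\<forall>r f t. form t f \<longrightarrow> f \<in> saturation (ideal_power I r) \<longrightarrow> omega I * r + e \<le> t \<longrightarrow> f \<in> ideal_power I r" ..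
  have "symbolic_power I m \<subseteq> ideal_power I r"
    if rm: "r \<le> m" and le: "real (omega I) * real r + real e \<le> real m * gamma I" for m r
  proof
    fix f assume f: "f \<in> symbolic_power I m"
    note Ir = is_ideal_ideal_power[OF I(1), of r]
    have "hcomp t f \<in> ideal_power I r" for t
    proof (cases "hcomp t f = 0")
      case True
      then show ?thesis by (simp add: is_ideal_zero[OF Ir])
    next
      case False
      have t: "hcomp t f \<in> symbolic_power I m"
        by (rule gradedD[OF graded_symbolic_power[OF I one] f])
      then have "alpha (symbolic_power I m) \<le> t" using False form_hcomp by (rule alpha_le)
      then have "real (omega I) * real r + real e \<le> real t"
        using le gamma_le[OF I(1,2) one nz, of m] by linarith
      then have "real (omega I * r + e) \<le> real t" by simp
      then have "omega I * r + e \<le> t" by (simp only: of_nat_le_iff)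
      moreover have "hcomp t f \<in> saturation (ideal_power I m)"
        using symbolic_power_subset_saturation[OF I one] t by (rule subsetD)
      \<comment> \<open>Here \<open>r \<le> m\<close> enters: \<open>I^m\<close> is contained in
        \<open>I^r\<close>.\<close>
      with saturation_mono[OF ideal_power_antimono[OF I(1) rm]]
      have "hcomp t f \<in> saturation (ideal_power I r)" by (rule subsetD)
      ultimately show ?thesis using e form_hcomp[of t f] by blast
    qed
    then have "(\<Sum>t\<in>S. hcomp t f) \<in> ideal_power I r" for S by (rule is_ideal_sum[OF Ir])
    moreover obtain S where "(\<Sum>t\<in>S. hcomp t f) = f" by (rule obtain_sum_hcomp[of f])
    ultimately show "f \<in> ideal_power I r" by metis
  qed
  then show ?thesis by (intro exI[of _ e] allI impI)
qed

theorem corollary2p3p9: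
  fixes N :: nat
    and I :: "('n::{finite,linorder}, 'k::alg_closed_field) mpoly set"
  assumes "N \<ge> 1"
    and "CARD('n) = N + 1"
    and "homogeneous_ideal I"
    and "defines_zero_dim_subscheme I"
  shows "(\<forall>c::real. c > real (omega I) / gamma I \<longrightarrow>
            finite {(m, r). 0 < m \<and> 0 < r \<and> real m / real r \<ge> c
                          \<and> \<not> symbolic_power I m \<subseteq> ideal_power I r})
       \<and> (\<forall>m r. 0 < m \<and> 0 < r \<and> real m / real r > real (omega I) / gamma I \<longrightarrow>
            (\<forall>\<^sub>F t in sequentially. symbolic_power I (m * t) \<subseteq> ideal_power I (r * t)))"
proof -
  have I: "is_ideal I" "graded I" using assms(3) by (simp_all add: homogeneous_ideal_iff)
  have "CARD('n) \<ge> 2" using assms(1,2) by simp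
  note nz = zero_dim_nonzero[OF I assms(4) this]
  note g = gamma_ge_1[OF I zero_dim_one_notin[OF assms(4)] nz]
    gamma_le_omega[OF I zero_dim_one_notin[OF assms(4)] nz]
  obtain e where e: "\<forall>m r. r \<le> m \<longrightarrow> real (omega I) * real r + real e \<le> real m * gamma I \<longrightarrow>
    symbolic_power I m \<subseteq> ideal_power I r"
    using symbolic_power_subset_ideal_power[OF I assms(4) nz] ..
  let ?S = "\<lambda>c. {(m, r). 0 < m \<and> 0 < r \<and> real m / real r \<ge> c \<and> \<not> symbolic_power I m \<subseteq> ideal_power I r}"
  have fin: "finite (?S c)" if c: "c > real (omega I) / gamma I" for c
  proof -
    have "1 \<le> real (omega I) / gamma I" using g by simp
    then have c1: "c > 1" using c by linarith
    \<comment> \<open>Since \<open>r \<le> m / c\<close>, the term \<open>omega I * r\<close> is at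
      most \<open>m * (omega I / c)\<close>; \<open>d\<close> is what remains of
      \<open>gamma I\<close> per unit of \<open>m\<close>. A failing pair satisfies
      \<open>m * d < e\<close>, which bounds \<open>m\<close>, and \<open>r \<le> m\<close>.\<close>
    define d where "d = gamma I - real (omega I) / c"
    have "real (omega I) < c * gamma I" using c g by (simp add: divide_less_eq)
    then have d: "d > 0" unfolding d_def using c1 by (simp add: divide_less_eq mult.commute)
    obtain M :: nat where M: "real e / d < real M" using reals_Archimedean2 by blast
    have "m \<le> M \<and> r \<le> M" if mr: "0 < m" "0 < r" "real m / real r \<ge> c" "\<not> symbolic_power I m \<subseteq> ideal_power I r" for m r
    proof -
      have cr: "c * real r \<le> real m" using mr(2,3) by (simp add: le_divide_eq)
      have "1 * real r \<le> c * real r" using c1 by (intro mult_right_mono) auto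
      then have "real r \<le> real m" using cr by linarith
      then have rm: "r \<le> m" by simp
      then have "\<not> real (omega I) * real r + real e \<le> real m * gamma I" using e mr(4) by blast
      moreover have "real r \<le> real m / c" using cr c1 by (simp add: le_divide_eq mult.commute)
      then have "real (omega I) * real r \<le> real (omega I) * (real m / c)" by (rule mult_left_mono) simp
      ultimately have "real m * gamma I < real (omega I) * (real m / c) + real e" by linarith
      then have "real m * d < real e" unfolding d_def by (simp add: algebra_simps)
      then have "real m < real e / d" using d by (simp add: less_divide_eq)
      then have "m \<le> M" using M by linarith
      then show ?thesis using rm by simp
    qed
    then have "?S c \<subseteq> {..M} \<times> {..M}" by auto
    then show ?thesis by (rule finite_subset) simp
  qed
  moreover have "\<forall>\<^sub>F t in sequentially. symbolic_power I (m * t) \<subseteq> ideal_power I (r * t)"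
    if mr: "0 < m" "0 < r" "real m / real r > real (omega I) / gamma I" for m r
  proof -
    let ?B = "{t. \<not> symbolic_power I (m * t) \<subseteq> ideal_power I (r * t)}"
    \<comment> \<open>All pairs \<open>(m * t, r * t)\<close> with \<open>t > 0\<close> have the
      ratio \<open>m / r\<close>, so the first claim applies with \<open>c = m / r\<close>. The
      value \<open>t = 0\<close> is set aside because the pairs there are positive.\<close>
    have "(\<lambda>t. (m * t, r * t)) ` (?B - {0}) \<subseteq> ?S (real m / real r)" using mr by auto
    then have "finite ((\<lambda>t. (m * t, r * t)) ` (?B - {0}))" using fin[OF mr(3)] by (rule finite_subset)
    moreover have "inj_on (\<lambda>t. (m * t, r * t)) (?B - {0})" using mr(1) by (auto simp: inj_on_def)
    ultimately have "finite (?B - {0})" by (rule finite_imageD)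
    then have "finite ?B" by simp
    then show ?thesis by (simp add: eventually_cofinite flip: cofinite_eq_sequentially)
  qed
  ultimately show ?thesis by blast
qed

end
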